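(* Let $\mathbf F=\{F_\gamma:\gamma\in T^*\}$ be a weight system for the cascade generator $\{W_\gamma:\gamma\in T^*\}$ on $(\Omega,\mathcal F,P)$, with $Z_\emptyset=E_P[W_\emptyset F_\emptyset]>0$. For $t\in T$ let $\mathcal F_{t,n}=\sigma\{W_{t|i},W_\gamma: i\ge0,\ |\gamma|\le n\}$. Fix $c_k\ge0$, $k\ge0$, such that $c_k$ is $\mathcal F_{t,0}$-measurable and $$E_{\mathcal Q_{\mathbf F}}\sum_k c_k<\infty .$$ Then for arbitrary $t\in T$ and all $n\ge 0$ $$b^{-n}\Big(\prod_{i\le n}W_{t|i}\Big)F_{t|n}\ \le\ \lambda_{\mathbf F,n}(T)\ \le\ b^{-n}\Big(\prod_{i\le n}W_{t|i}\Big)F_{t|n}+\sup_{j}\Big(\frac{b^{-j}\prod_{i\le j}W_{t|i}}{c_j}\Big)M_n,$$ where $$M_n=\sum_{j=0}^{n-1}c_j\,b^{-(n-j)}\sum_{|\gamma|=n-j,\ \gamma_1\ne t_{j+1}}\Big(\prod_{i=1}^{n-j}W_{(t|j)*(\gamma|i)}\Big)F_{(t|j)*\gamma}$$ is a nonnegative $P_{\mathbf F,t}$-submartingale with respect to $(\mathcal F_{t,n})_n$, whose Doob decomposition has the predictable part $$A_n=\frac{b-1}{b}\sum_{j\le n-1}c_j.$$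
   Context: Tree. Fix an integer $b\ge2$. $T=\{0,\dots,b-1\}^{\mathbb N}$ with the ultrametric $\rho(s,t)=b^{-\inf\{n:s_n\ne t_n\}}$ and its Borel $\sigma$-field $\mathcal B$; $\lambda$ is the normalized Haar measure on $T$ (the product of uniform measures). $T^*$ is the set of all finite words over $\{0,\dots,b-1\}$, including the empty word $\emptyset$ (the root). $|\gamma|$ is the length of $\gamma=(\gamma_1,\dots,\gamma_{|\gamma|})\in T^*$, and $\gamma*\gamma'$ denotes concatenation. For $t\in T$, $t|n=(t_1,\dots,t_n)$, $t|0=\emptyset$; for $\gamma\in T^*$ and $j\le|\gamma|$, $\gamma|j$ is the prefix of length $j$. Products written $\prod_{i\le n}$ run over $i=0,1,\dots,n$. Cascade generator. Given a probability measure $p_0(dx)$ on $[0,\infty)$ and mean-one transition probability kernels $q_n(dx|x_0,\dots,x_{n-1})$, $n\ge1$, on $[0,\infty)$ (that is, $\int x\,q_n(dx|x_0,\dots,x_{n-1})=1$), let $\Omega=[0,\infty)^{T^*}$ with product $\sigma$-field $\mathcal F$, let $W_\gamma(\omega)=\omega_\gamma$ and $\mathcal F_n=\sigma\{W_\gamma:|\gamma|\le n\}$, and let $P$ be the probability on $(\Omega,\mathcal F)$ such that: $W_\emptyset$ has law $p_0$; for every $t\in T$ and $n\ge0$ the conditional law of $W_{t|n+1}$ given $\mathcal F_n$ is $q_{n+1}(dx|W_{t|0},\dots,W_{t|n})$; and the variables $W_\gamma$, $|\gamma|=n+1$, are conditionally independent given $\mathcal F_n$. Positive $T$-martingale. A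 sequence $\{Q_n\}$ of nonnegative functions on $T\times\Omega$ such that for every $t\in T$, $\{Q_n(t,\cdot)\}_n$ is a martingale adapted to $(\mathcal F_n)$ under $P$, and for $P$-a.e. $\omega$ the functions $Q_n(\cdot,\omega)$ are Borel measurable. Weight system. A family $\mathbf F=\{F_\gamma:\gamma\in T^*\}$ of functions $F_\gamma:\Omega\to[0,\infty)$ with $F_\gamma$ measurable with respect to $\sigma\{W_{\gamma|j}:j\le|\gamma|\}$ and such that $$Q_{\mathbf F,n}(t)=\Big(\prod_{j\le n}W_{t|j}\Big)F_{t|n},\qquad t\in T,$$ is a positive $T$-martingale. Let $\lambda_{\mathbf F,n}=Q_{\mathbf F,n}\lambda$ be the random measure $\lambda_{\mathbf F,n}(dt)=Q_{\mathbf F,n}(t)\lambda(dt)$. The probabilities $\mathcal Q_{\mathbf F}$ and $P_{\mathbf F,t}$. Assume $Z_\emptyset=E_P[W_\emptyset F_\emptyset]>0$. $\mathcal Q_{\mathbf F}$ is the probability on $\Omega\times T$ (obtained by Kolmogorov extension) such that, for every $n$ and every bounded $\mathcal F_n\otimes\mathcal B$-measurable $f$, $$\int_{\Omega\times T}f\,d\mathcal Q_{\mathbf F}=Z_\emptyset^{-1}E_P\int_Tf(\omega,t)Q_{\mathbf F,n}(t)\,\lambda(dt).$$ It disintegrates as $\mathcal Q_{\mathbf F}(d\omega,dt)=P_{\mathbf F,t}(d\omega)\lambda(dt)$, where $P_{\mathbf F,t}$ is the probability on $(\Omega,\mathcal F)$ with $\frac{dP_{\mathbf F,t}}{dP}\big|_{\mathcal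 F_n}=Z_\emptyset^{-1}\big(\prod_{j\le n}W_{t|j}\big)F_{t|n}$ for all $n$.
   Formalization: A_n is corrected to ((b-1)/b)Σ_{j<n} c_j F_{t|j} (as printed if c_jF_{t|j}=c_j a.s.); for every t the submartingale is meant with [0,∞]-valued expectations, and in the ordinary sense if A_n is integrable, which E_Q Σc_k<∞ gives for λ-a.e. t when the printed A_n is right. *)

theory Defs
  imports "HOL-Probability.Probability"
begin

section \<open>The tree\<close>

text \<open>The boundary \<open>T\<close> is \<open>space (haar b)\<close>. Each finite factor carries its power set as
  sigma-field, so \<open>sets (haar b)\<close>, the product sigma-field, is the Borel sigma-field of the
  ultrametric.\<close>

definition haar :: "nat \<Rightarrow> (nat \<Rightarrow> nat) measure" where
  "haar b = PiM UNIV (\<lambda>_. uniform_count_measure {..<b})"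

definition tree_words :: "nat \<Rightarrow> nat list set" where
  "tree_words b = lists {..<b}"

text \<open>Boundary points are indexed from 0: the letter usually written \<open>t\<^sub>j\<^sub>+\<^sub>1\<close> is \<open>t j\<close>.\<close>

definition prefix_of :: "(nat \<Rightarrow> nat) \<Rightarrow> nat \<Rightarrow> nat list" where
  "prefix_of t n = map t [0..<n]"


section \<open>Cascade generators\<close>

definition nonneg_borel :: "real measure" where
  "nonneg_borel = restrict_space borel {0..}"

text \<open>Only the underlying measurable space of \<open>path_space b\<close> is used. The variable
  \<open>W\<^sub>\<gamma>\<close> is evaluation at \<open>\<gamma>\<close>.\<close>

definition path_space :: "nat \<Rightarrow> (nat list \<Rightarrow> real) measure" where
  "path_space b = PiM (tree_words b) (\<lambda>_. nonneg_borel)"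

definition coord_algebra :: "nat \<Rightarrow> nat list set \<Rightarrow> (nat list \<Rightarrow> real) measure" where
  "coord_algebra b \<Gamma> = sigma (space (path_space b))
     {{\<omega> \<in> space (path_space b). \<omega> \<gamma> \<in> A} | \<gamma> A. \<gamma> \<in> \<Gamma> \<and> A \<in> sets nonneg_borel}"

definition level_algebra :: "nat \<Rightarrow> nat \<Rightarrow> (nat list \<Rightarrow> real) measure" where
  "level_algebra b n = coord_algebra b {\<gamma> \<in> tree_words b. length \<gamma> \<le> n}"

definition spine_algebra :: "nat \<Rightarrow> (nat \<Rightarrow> nat) \<Rightarrow> nat \<Rightarrow> (nat list \<Rightarrow> real) measure" where
  "spine_algebra b t n =
     coord_algebra b (range (prefix_of t) \<union> {\<gamma> \<in> tree_words b. length \<gamma> \<le> n})"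

definition cond_indep_vars ::
  "'a measure \<Rightarrow> 'a measure \<Rightarrow> ('i \<Rightarrow> 'b measure) \<Rightarrow> ('i \<Rightarrow> 'a \<Rightarrow> 'b) \<Rightarrow> 'i set \<Rightarrow> bool" where
  "cond_indep_vars M G N X I \<longleftrightarrow>
     (\<forall>i\<in>I. X i \<in> M \<rightarrow>\<^sub>M N i) \<and>
     (\<forall>J\<subseteq>I. finite J \<longrightarrow> (\<forall>A. (\<forall>j\<in>J. A j \<in> sets (N j)) \<longrightarrow>
        (AE \<omega> in M. real_cond_exp M G (\<lambda>\<omega>'. \<Prod>j\<in>J. indicator (A j) (X j \<omega>')) \<omega> =
           (\<Prod>j\<in>J. real_cond_exp M G (\<lambda>\<omega>'. indicator (A j) (X j \<omega>')) \<omega>))))"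

definition mean_one_kernels :: "(nat \<Rightarrow> (nat \<Rightarrow> real) \<Rightarrow> real measure) \<Rightarrow> bool" where
  "mean_one_kernels q \<longleftrightarrow>
     (\<forall>n\<ge>1. q n \<in> PiM {..<n} (\<lambda>_. nonneg_borel) \<rightarrow>\<^sub>M prob_algebra nonneg_borel \<and>
        (\<forall>x \<in> space (PiM {..<n} (\<lambda>_. nonneg_borel)). (\<integral>\<^sup>+ y. ennreal y \<partial>q n x) = 1))"

definition cascade_generator ::
  "nat \<Rightarrow> real measure \<Rightarrow> (nat \<Rightarrow> (nat \<Rightarrow> real) \<Rightarrow> real measure) \<Rightarrow>
   (nat list \<Rightarrow> real) measure \<Rightarrow> bool" where
  "cascade_generator b p0 q P \<longleftrightarrow>
     p0 \<in> space (prob_algebra nonneg_borel) \<and> mean_one_kernels q \<and>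
     prob_space P \<and> sets P = sets (path_space b) \<and>
     distr P nonneg_borel (\<lambda>\<omega>. \<omega> []) = p0 \<and>
     (\<forall>t \<in> space (haar b). \<forall>n. \<forall>A \<in> sets nonneg_borel.
        AE \<omega> in P. real_cond_exp P (level_algebra b n)
             (\<lambda>\<omega>'. indicator A (\<omega>' (prefix_of t (Suc n)))) \<omega> =
           measure (q (Suc n) (\<lambda>i\<in>{..<Suc n}. \<omega> (prefix_of t i))) A) \<and>
     (\<forall>n. cond_indep_vars P (level_algebra b n) (\<lambda>_. nonneg_borel) (\<lambda>\<gamma> \<omega>. \<omega> \<gamma>)
        {\<gamma> \<in> tree_words b. length \<gamma> = Suc n})"


section \<open>Martingales and the Doob decomposition in discrete time\<close>

definition adapted ::
  "'a measure \<Rightarrow> (nat \<Rightarrow> 'a measure) \<Rightarrow> (nat \<Rightarrow> 'a \<Rightarrow> real) \<Rightarrow> bool" where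
  "adapted M G X \<longleftrightarrow> filtration (space M) G \<and> (\<forall>n. subalgebra M (G n)) \<and>
     (\<forall>n. X n \<in> borel_measurable (G n))"

definition martingale ::
  "'a measure \<Rightarrow> (nat \<Rightarrow> 'a measure) \<Rightarrow> (nat \<Rightarrow> 'a \<Rightarrow> real) \<Rightarrow> bool" where
  "martingale M G X \<longleftrightarrow> adapted M G X \<and> (\<forall>n. integrable M (X n)) \<and>
     (\<forall>n. AE \<omega> in M. real_cond_exp M (G n) (X (Suc n)) \<omega> = X n \<omega>)"

definition submartingale ::
  "'a measure \<Rightarrow> (nat \<Rightarrow> 'a measure) \<Rightarrow> (nat \<Rightarrow> 'a \<Rightarrow> real) \<Rightarrow> bool" where
  "submartingale M G X \<longleftrightarrow> adapted M G X \<and> (\<forall>n. integrable M (X n)) \<and>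
     (\<forall>n. AE \<omega> in M. X n \<omega> \<le> real_cond_exp M (G n) (X (Suc n)) \<omega>)"

definition predictable_from_zero ::
  "'a measure \<Rightarrow> (nat \<Rightarrow> 'a measure) \<Rightarrow> (nat \<Rightarrow> 'a \<Rightarrow> real) \<Rightarrow> bool" where
  "predictable_from_zero M G A \<longleftrightarrow>
     (\<forall>\<omega>\<in>space M. A 0 \<omega> = 0) \<and> (\<forall>n. A (Suc n) \<in> borel_measurable (G n))"

definition doob_predictable_part ::
  "'a measure \<Rightarrow> (nat \<Rightarrow> 'a measure) \<Rightarrow> (nat \<Rightarrow> 'a \<Rightarrow> real) \<Rightarrow> (nat \<Rightarrow> 'a \<Rightarrow> real) \<Rightarrow> bool" where
  "doob_predictable_part M G X A \<longleftrightarrow> predictable_from_zero M G A \<and>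
     martingale M G (\<lambda>n \<omega>. X n \<omega> - A n \<omega>)"

text \<open>The same two notions for a nonnegative process that need not be integrable: conditional
  expectations are taken in \<open>[0,\<infinity>]\<close>, and since \<open>X n - A n\<close> may then fail to be integrable, the
  Doob decomposition is expressed by the increments of \<open>A\<close>.\<close>

definition nonneg_submartingale ::
  "'a measure \<Rightarrow> (nat \<Rightarrow> 'a measure) \<Rightarrow> (nat \<Rightarrow> 'a \<Rightarrow> real) \<Rightarrow> bool" where
  "nonneg_submartingale M G X \<longleftrightarrow> adapted M G X \<and> (\<forall>n. \<forall>\<omega>\<in>space M. 0 \<le> X n \<omega>) \<and>
     (\<forall>n. AE \<omega> in M. ennreal (X n \<omega>) \<le> nn_cond_exp M (G n) (\<lambda>\<omega>'. ennreal (X (Suc n) \<omega>')) \<omega>)"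

definition nonneg_doob_predictable_part ::
  "'a measure \<Rightarrow> (nat \<Rightarrow> 'a measure) \<Rightarrow> (nat \<Rightarrow> 'a \<Rightarrow> real) \<Rightarrow> (nat \<Rightarrow> 'a \<Rightarrow> real) \<Rightarrow> bool" where
  "nonneg_doob_predictable_part M G X A \<longleftrightarrow> predictable_from_zero M G A \<and>
     (\<forall>n. \<forall>\<omega>\<in>space M. A n \<omega> \<le> A (Suc n) \<omega>) \<and>
     (\<forall>n. AE \<omega> in M. nn_cond_exp M (G n) (\<lambda>\<omega>'. ennreal (X (Suc n) \<omega>')) \<omega> =
        ennreal (X n \<omega>) + ennreal (A (Suc n) \<omega> - A n \<omega>))"


section \<open>Weight systems\<close>

definition positive_T_martingale ::
  "nat \<Rightarrow> (nat list \<Rightarrow> real) measure \<Rightarrow>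
   (nat \<Rightarrow> (nat \<Rightarrow> nat) \<Rightarrow> (nat list \<Rightarrow> real) \<Rightarrow> real) \<Rightarrow> bool" where
  "positive_T_martingale b P Q \<longleftrightarrow>
     (\<forall>n. \<forall>t\<in>space (haar b). \<forall>\<omega>\<in>space (path_space b). 0 \<le> Q n t \<omega>) \<and>
     (\<forall>t\<in>space (haar b). martingale P (level_algebra b) (\<lambda>n. Q n t)) \<and>
     (AE \<omega> in P. \<forall>n. (\<lambda>t. Q n t \<omega>) \<in> borel_measurable (haar b))"

definition path_weight :: "(nat \<Rightarrow> nat) \<Rightarrow> nat \<Rightarrow> (nat list \<Rightarrow> real) \<Rightarrow> real" where
  "path_weight t n \<omega> = (\<Prod>i\<le>n. \<omega> (prefix_of t i))"

definition weighted_density ::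
  "(nat list \<Rightarrow> (nat list \<Rightarrow> real) \<Rightarrow> real) \<Rightarrow> nat \<Rightarrow> (nat \<Rightarrow> nat) \<Rightarrow> (nat list \<Rightarrow> real) \<Rightarrow> real" where
  "weighted_density F n t \<omega> = path_weight t n \<omega> * F (prefix_of t n) \<omega>"

definition weight_system ::
  "nat \<Rightarrow> (nat list \<Rightarrow> real) measure \<Rightarrow> (nat list \<Rightarrow> (nat list \<Rightarrow> real) \<Rightarrow> real) \<Rightarrow> bool" where
  "weight_system b P F \<longleftrightarrow>
     (\<forall>\<gamma>\<in>tree_words b. (\<forall>\<omega>\<in>space (path_space b). 0 \<le> F \<gamma> \<omega>) \<and>
        F \<gamma> \<in> borel_measurable (coord_algebra b {take j \<gamma> | j. j \<le> length \<gamma>})) \<and>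
     positive_T_martingale b P (weighted_density F)"

definition cascade_measure ::
  "nat \<Rightarrow> (nat list \<Rightarrow> (nat list \<Rightarrow> real) \<Rightarrow> real) \<Rightarrow> nat \<Rightarrow> (nat list \<Rightarrow> real) \<Rightarrow> (nat \<Rightarrow> nat) measure" where
  "cascade_measure b F n \<omega> = density (haar b) (\<lambda>t. ennreal (weighted_density F n t \<omega>))"

definition root_mass ::
  "(nat list \<Rightarrow> real) measure \<Rightarrow> (nat list \<Rightarrow> (nat list \<Rightarrow> real) \<Rightarrow> real) \<Rightarrow> real" where
  "root_mass P F = (\<integral>\<omega>. \<omega> [] * F [] \<omega> \<partial>P)"

text \<open>The following two predicates determine their measure argument uniquely, because the level
  sigma-fields generate the product sigma-field. Existence is Kolmogorov's extension theorem.\<close>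

definition cascade_joint_law ::
  "nat \<Rightarrow> (nat list \<Rightarrow> real) measure \<Rightarrow> (nat list \<Rightarrow> (nat list \<Rightarrow> real) \<Rightarrow> real) \<Rightarrow>
   ((nat list \<Rightarrow> real) \<times> (nat \<Rightarrow> nat)) measure \<Rightarrow> bool" where
  "cascade_joint_law b P F QF \<longleftrightarrow>
     prob_space QF \<and> sets QF = sets (path_space b \<Otimes>\<^sub>M haar b) \<and>
     (\<forall>n. \<forall>f \<in> borel_measurable (level_algebra b n \<Otimes>\<^sub>M haar b).
        (\<exists>C. \<forall>x \<in> space (path_space b \<Otimes>\<^sub>M haar b). \<bar>f x\<bar> \<le> C) \<longrightarrow>
        (\<integral>x. f x \<partial>QF) =
          (\<integral>\<omega>. (\<integral>t. f (\<omega>, t) * weighted_density F n t \<omega> \<partial>haar b) \<partial>P) / root_mass P F)"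

definition spine_law ::
  "nat \<Rightarrow> (nat list \<Rightarrow> real) measure \<Rightarrow> (nat list \<Rightarrow> (nat list \<Rightarrow> real) \<Rightarrow> real) \<Rightarrow>
   (nat \<Rightarrow> nat) \<Rightarrow> (nat list \<Rightarrow> real) measure \<Rightarrow> bool" where
  "spine_law b P F t Pt \<longleftrightarrow>
     prob_space Pt \<and> sets Pt = sets (path_space b) \<and>
     (\<forall>n. restr_to_subalg Pt (level_algebra b n) =
        density (restr_to_subalg P (level_algebra b n))
          (\<lambda>\<omega>. ennreal (weighted_density F n t \<omega> / root_mass P F)))"


section \<open>The off-spine process\<close>

definition off_spine_sum ::
  "nat \<Rightarrow> (nat list \<Rightarrow> (nat list \<Rightarrow> real) \<Rightarrow> real) \<Rightarrow>
   (nat \<Rightarrow> (nat list \<Rightarrow> real) \<Rightarrow> (nat \<Rightarrow> nat) \<Rightarrow> real) \<Rightarrow>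
   (nat \<Rightarrow> nat) \<Rightarrow> nat \<Rightarrow> (nat list \<Rightarrow> real) \<Rightarrow> real" where
  "off_spine_sum b F c t n \<omega> =
     (\<Sum>j<n. c j \<omega> t * (1 / real b) ^ (n - j) *
        (\<Sum>\<gamma> | \<gamma> \<in> tree_words b \<and> length \<gamma> = n - j \<and> hd \<gamma> \<noteq> t j.
           (\<Prod>i=1..n - j. \<omega> (prefix_of t j @ take i \<gamma>)) * F (prefix_of t j @ \<gamma>) \<omega>))"

definition drift ::
  "nat \<Rightarrow> (nat \<Rightarrow> (nat list \<Rightarrow> real) \<Rightarrow> (nat \<Rightarrow> nat) \<Rightarrow> real) \<Rightarrow>
   (nat \<Rightarrow> nat) \<Rightarrow> nat \<Rightarrow> (nat list \<Rightarrow> real) \<Rightarrow> real" where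
  "drift b d t n \<omega> = (real b - 1) / real b * (\<Sum>j<n. d j \<omega> t)"

text \<open>The conditional mean of \<open>W\<^sub>\<gamma> F\<^sub>\<gamma>\<close>, for a child \<open>\<gamma>\<close> of the spine vertex \<open>t|j\<close>, is the weight
  of the parent, so the drift of the off-spine sum is driven by the following product and not by
  \<open>c\<close> alone.\<close>

definition weighted_coeff ::
  "(nat list \<Rightarrow> (nat list \<Rightarrow> real) \<Rightarrow> real) \<Rightarrow>
   (nat \<Rightarrow> (nat list \<Rightarrow> real) \<Rightarrow> (nat \<Rightarrow> nat) \<Rightarrow> real) \<Rightarrow>
   nat \<Rightarrow> (nat list \<Rightarrow> real) \<Rightarrow> (nat \<Rightarrow> nat) \<Rightarrow> real" where
  "weighted_coeff F c j \<omega> t = c j \<omega> t * F (prefix_of t j) \<omega>"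

text \<open>Quotients are formed in \<open>[0,\<infinity>]\<close>: \<open>x / 0\<close> is \<open>\<infinity>\<close> for positive \<open>x\<close>, and \<open>0 / 0\<close> is \<open>0\<close>.\<close>

definition spine_sup ::
  "nat \<Rightarrow> (nat \<Rightarrow> (nat list \<Rightarrow> real) \<Rightarrow> (nat \<Rightarrow> nat) \<Rightarrow> real) \<Rightarrow>
   (nat \<Rightarrow> nat) \<Rightarrow> (nat list \<Rightarrow> real) \<Rightarrow> ennreal" where
  "spine_sup b c t \<omega> =
     (SUP j. ennreal ((1 / real b) ^ j * path_weight t j \<omega>) / ennreal (c j \<omega> t))"

text \<open>In \<open>ennreal\<close> one has \<open>\<infinity> * 0 = 0\<close>; an upper bound with infinite factor must instead be vacuous
  (if all \<open>c j\<close> vanish, the off-spine sum is 0 while the total mass can be large).\<close>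

definition times_top :: "ennreal \<Rightarrow> ennreal \<Rightarrow> ennreal" where
  "times_top x y = (if x = \<infinity> then \<infinity> else x * y)"

end

theory Submission
  imports Defs
begin

text \<open>Attach to every vertex \<open>\<gamma>\<close> the weight \<open>Q\<^sub>\<gamma> = (\<Prod>i\<le>|\<gamma>|. W\<^bsub>\<gamma>|i\<^esub>) F\<^sub>\<gamma>\<close>. The total mass of the
  \<open>n\<close>-th random measure is \<open>b\<^sup>-\<^sup>n\<close> times the sum of \<open>Q\<^sub>\<gamma>\<close> over \<open>|\<gamma>| = n\<close>. Both pathwise bounds are read
  off from this finite sum: the lower one keeps the term of \<open>t|n\<close>, the upper one sorts the remaining
  vertices by the level \<open>j\<close> at which they leave the ray \<open>t\<close> and bounds the part of the weight that
  lies on the ray, \<open>b\<^sup>-\<^sup>j \<Prod>i\<le>j. W\<^bsub>t|i\<^esub>\<close>, by \<open>c\<^sub>j\<close> times the supremum (\<open>total_mass_bounds\<close>).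

  The probabilistic part rests on one identity. If \<open>|\<gamma>| = n+1\<close> and \<open>\<gamma>\<close> is not on the ray \<open>t\<close>, then
  \<open>Q\<^sub>\<gamma>\<close> and \<open>Q\<^bsub>\<gamma>|n\<^esub>\<close> have the same integrals under the spine law against every nonnegative function
  that depends on the levels up to \<open>n\<close> and on the whole spine (\<open>vertex_weight_step_spine\<close>). So neither
  revealing the future of the spine nor tilting by the spine density destroys the martingale property
  of a weight off the spine. Under \<open>P\<close>, and for functions that see the spine up to level \<open>n+1\<close>, this
  holds because siblings are conditionally independent: an event about \<open>W\<^bsub>t|n+1\<^esub>\<close> may be replaced by
  its conditional probability given the levels up to \<open>n\<close>, and then the weight system's martingale
  property applies. Deeper spine variables are integrated out one at a time; the kernels that govern them
  read the spine only, so the result is again a test function of the same kind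
  (\<open>vertex_weight_step_trunk\<close>). The density of the spine law on level \<open>N\<close> is itself a function of the
  spine up to level \<open>N\<close>, hence an admissible factor of the test function, and this carries the identity
  over to the spine law.

  Under the spine law the product \<open>\<Prod>i\<le>j. W\<^bsub>t|i\<^esub>\<close> is almost surely positive. Dividing by it gives the
  conditional mean of each summand of the off-spine process, and one sums over the last letter of
  \<open>\<gamma>\<close>: a branch that left the ray at \<open>j < n\<close> has \<open>b\<close> children per vertex and reproduces its own
  contribution, whereas the \<open>b - 1\<close> siblings of \<open>t|n+1\<close> are new, each with mean \<open>F\<^bsub>t|n\<^esub>\<close>. They account
  for the increment \<open>(b-1)/b c\<^sub>n F\<^bsub>t|n\<^esub>\<close> (\<open>nn_cond_exp_X\<close>). These conditional means live in \<open>[0,\<infinity>]\<close>; if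
  the drift is integrable, so is the process, by induction on the level, and the identity becomes an ordinary
  Doob decomposition (\<open>doob_of_nonneg_doob\<close>). For almost every ray the coefficients are integrable,
  because the joint law disintegrates into the spine laws (\<open>joint_law_disintegration\<close>).\<close>

section \<open>Words, prefixes and cylinders\<close>

definition level_words :: "nat \<Rightarrow> nat \<Rightarrow> nat list set" where
  "level_words b n = {\<gamma> \<in> tree_words b. length \<gamma> = n}"

lemma finite_level_words: "finite (level_words b n)"
proof -
  have "level_words b n = {xs. set xs \<subseteq> {..<b} \<and> length xs = n}"
    by (auto simp: level_words_def tree_words_def)
  then show ?thesis by (simp add: finite_lists_length_eq)
qed

lemma in_space_haar: "t \<in> space (haar b) \<longleftrightarrow> (\<forall>i. t i < b)"
  by (auto simp: haar_def space_PiM space_uniform_count_measure PiE_def Pi_def)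

lemma length_prefix_of [simp]: "length (prefix_of t n) = n"
  by (simp add: prefix_of_def)

lemma nth_prefix_of [simp]: "i < n \<Longrightarrow> prefix_of t n ! i = t i"
  by (simp add: prefix_of_def)

lemma take_prefix_of [simp]: "take i (prefix_of t n) = prefix_of t (min i n)"
  by (cases "i \<le> n") (simp_all add: prefix_of_def take_map)

lemma prefix_of_eq_iff: "length \<gamma> = n \<Longrightarrow> prefix_of t n = \<gamma> \<longleftrightarrow> (\<forall>i<n. t i = \<gamma> ! i)"
  by (auto simp: list_eq_iff_nth_eq)

lemma prefix_of_in_tree_words: "t \<in> space (haar b) \<Longrightarrow> prefix_of t n \<in> tree_words b"
  by (auto simp: in_space_haar prefix_of_def tree_words_def)

lemma prefix_of_in_level_words: "t \<in> space (haar b) \<Longrightarrow> prefix_of t n \<in> level_words b n"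
  by (simp add: level_words_def prefix_of_in_tree_words)

lemma take_in_tree_words: "\<gamma> \<in> tree_words b \<Longrightarrow> take i \<gamma> \<in> tree_words b"
  by (auto simp: tree_words_def dest: in_set_takeD)

lemma ray_through_word:
  assumes "\<gamma> \<in> tree_words b" "0 < b"
  obtains s where "s \<in> space (haar b)" "prefix_of s (length \<gamma>) = \<gamma>"
proof
  let ?s = "\<lambda>i. if i < length \<gamma> then \<gamma> ! i else 0"
  show "?s \<in> space (haar b)"
    using assms by (auto simp: in_space_haar tree_words_def)
  show "prefix_of ?s (length \<gamma>) = \<gamma>"
    by (subst prefix_of_eq_iff) auto
qed

lemma prob_space_haar: "0 < b \<Longrightarrow> prob_space (haar b)"
  unfolding haar_def by (intro prob_space_PiM prob_space_uniform_count_measure) auto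

lemma
  assumes b: "0 < b" and \<gamma>: "\<gamma> \<in> level_words b n"
  shows cylinder_sets: "{t \<in> space (haar b). prefix_of t n = \<gamma>} \<in> sets (haar b)"
    and emeasure_cylinder: "emeasure (haar b) {t \<in> space (haar b). prefix_of t n = \<gamma>} = ennreal ((1 / real b) ^ n)"
proof -
  let ?M = "\<lambda>_::nat. uniform_count_measure {..<b}"
  have len: "length \<gamma> = n" and lt: "\<And>i. i < n \<Longrightarrow> \<gamma> ! i < b"
    using \<gamma> by (auto simp: level_words_def tree_words_def)
  have eq: "{t \<in> space (haar b). prefix_of t n = \<gamma>} =
      prod_emb UNIV ?M {..<n} (Pi\<^sub>E {..<n} (\<lambda>i. {\<gamma> ! i}))"
    using lt by (auto simp: prefix_of_eq_iff[OF len] haar_def prod_emb_def space_PiM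
        space_uniform_count_measure PiE_iff Pi_def)
  show "{t \<in> space (haar b). prefix_of t n = \<gamma>} \<in> sets (haar b)"
    unfolding eq unfolding haar_def using lt
    by (intro sets_PiM_I) (auto simp: sets_uniform_count_measure)
  have "emeasure (haar b) {t \<in> space (haar b). prefix_of t n = \<gamma>} =
      (\<Prod>i<n. emeasure (uniform_count_measure {..<b}) {\<gamma> ! i})"
    unfolding eq unfolding haar_def using lt b
    by (intro emeasure_PiM_emb prob_space_uniform_count_measure) (auto simp: sets_uniform_count_measure)
  also have "\<dots> = (\<Prod>i<n. ennreal (1 / real b))"
    using lt by (intro prod.cong refl) (subst emeasure_uniform_count_measure, auto)
  finally show "emeasure (haar b) {t \<in> space (haar b). prefix_of t n = \<gamma>} = ennreal ((1 / real b) ^ n)"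
    by (simp add: ennreal_power)
qed

lemma sum_over_prefixes:
  fixes f :: "nat list \<Rightarrow> 'a::semiring_1"
  assumes "t \<in> space (haar b)"
  shows "f (prefix_of t n) =
    (\<Sum>\<gamma>\<in>level_words b n. f \<gamma> * indicator {t \<in> space (haar b). prefix_of t n = \<gamma>} t)"
proof -
  have "(\<Sum>\<gamma>\<in>level_words b n. f \<gamma> * indicator {t \<in> space (haar b). prefix_of t n = \<gamma>} t) =
      (\<Sum>\<gamma>\<in>level_words b n. if \<gamma> = prefix_of t n then f \<gamma> else 0)"
    using assms by (intro sum.cong) (auto simp: indicator_def)
  then show ?thesis
    using assms by (simp add: finite_level_words prefix_of_in_level_words)
qed

lemma nn_integral_prefix:
  assumes "0 < b"
  shows "(\<integral>\<^sup>+ t. f (prefix_of t n) \<partial>haar b) = (\<Sum>\<gamma>\<in>level_words b n. f \<gamma> * ennreal ((1 / real b) ^ n))"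
proof -
  have [measurable]: "\<gamma> \<in> level_words b n \<Longrightarrow> {t \<in> space (haar b). prefix_of t n = \<gamma>} \<in> sets (haar b)" for \<gamma>
    using assms by (rule cylinder_sets)
  have "(\<integral>\<^sup>+ t. f (prefix_of t n) \<partial>haar b) =
    (\<integral>\<^sup>+ t. (\<Sum>\<gamma>\<in>level_words b n. f \<gamma> * indicator {t \<in> space (haar b). prefix_of t n = \<gamma>} t) \<partial>haar b)"
    by (intro nn_integral_cong sum_over_prefixes)
  also have "\<dots> = (\<Sum>\<gamma>\<in>level_words b n. \<integral>\<^sup>+ t. f \<gamma> * indicator {t \<in> space (haar b). prefix_of t n = \<gamma>} t \<partial>haar b)"
    by (intro nn_integral_sum) auto
  also have "\<dots> = (\<Sum>\<gamma>\<in>level_words b n. f \<gamma> * ennreal ((1 / real b) ^ n))"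
    using assms by (intro sum.cong refl) (simp add: nn_integral_cmult_indicator emeasure_cylinder)
  finally show ?thesis .
qed

text \<open>Off-spine vertices are classified by the last vertex they share with the ray: \<open>j\<close> is the least
  index at which the letters differ.\<close>
lemma first_divergence:
  assumes "\<gamma> \<in> level_words b n" "\<gamma> \<noteq> prefix_of t n"
  obtains j \<gamma>' where "j < n" "\<gamma>' \<in> level_words b (n - j)" "hd \<gamma>' \<noteq> t j" "\<gamma> = prefix_of t j @ \<gamma>'"
proof -
  have len: "length \<gamma> = n" using assms by (simp add: level_words_def)
  define j where "j = (LEAST j. j < n \<and> t j \<noteq> \<gamma> ! j)"
  have "\<exists>j. j < n \<and> t j \<noteq> \<gamma> ! j"
    using assms(2) prefix_of_eq_iff[OF len, of t] by auto
  then have j: "j < n \<and> t j \<noteq> \<gamma> ! j" unfolding j_def by (rule LeastI_ex)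
  have before: "t i = \<gamma> ! i" if "i < j" for i
    using not_less_Least[of i "\<lambda>j. j < n \<and> t j \<noteq> \<gamma> ! j"] that j unfolding j_def by auto
  have "prefix_of t j = take j \<gamma>"
    using before j len by (subst prefix_of_eq_iff) auto
  then have "\<gamma> = prefix_of t j @ drop j \<gamma>" by simp
  moreover have "drop j \<gamma> \<in> level_words b (n - j)"
    using assms(1) by (auto simp: level_words_def tree_words_def dest: in_set_dropD)
  moreover have "hd (drop j \<gamma>) \<noteq> t j"
    using j len by (simp add: hd_drop_conv_nth)
  ultimately show ?thesis using j that by blast
qed

section \<open>Coordinate sigma-algebras\<close>

lemma space_path_space_nonneg: "\<omega> \<in> space (path_space b) \<Longrightarrow> \<gamma> \<in> tree_words b \<Longrightarrow> 0 \<le> \<omega> \<gamma>"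
  by (auto simp: path_space_def space_PiM nonneg_borel_def space_restrict_space)

lemma space_coord_algebra [simp]: "space (coord_algebra b \<Gamma>) = space (path_space b)"
  unfolding coord_algebra_def by (intro space_measure_of) auto

lemma sets_coord_algebra:
  "sets (coord_algebra b \<Gamma>) = sigma_sets (space (path_space b))
     {{\<omega> \<in> space (path_space b). \<omega> \<gamma> \<in> A} | \<gamma> A. \<gamma> \<in> \<Gamma> \<and> A \<in> sets nonneg_borel}"
  unfolding coord_algebra_def by (intro sets_measure_of) auto

lemma sets_coord_algebra_mono: "\<Gamma> \<subseteq> \<Delta> \<Longrightarrow> sets (coord_algebra b \<Gamma>) \<subseteq> sets (coord_algebra b \<Delta>)"
  unfolding sets_coord_algebra by (intro sigma_sets_mono') blast

lemma measurable_coord_algebra_mono: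
  "f \<in> coord_algebra b \<Gamma> \<rightarrow>\<^sub>M N \<Longrightarrow> \<Gamma> \<subseteq> \<Delta> \<Longrightarrow> f \<in> coord_algebra b \<Delta> \<rightarrow>\<^sub>M N"
  using sets_coord_algebra_mono[of \<Gamma> \<Delta> b] by (auto simp: measurable_def)

lemma subalgebra_coord_algebra:
  assumes "sets M = sets (path_space b)" "\<Gamma> \<subseteq> tree_words b"
  shows "subalgebra M (coord_algebra b \<Gamma>)"
proof -
  have "{\<omega> \<in> space (path_space b). \<omega> \<gamma> \<in> A} \<in> sets (path_space b)"
    if "\<gamma> \<in> \<Gamma>" "A \<in> sets nonneg_borel" for \<gamma> A
    unfolding path_space_def using that assms(2) by (intro sets_Collect_single) auto
  then have "sets (coord_algebra b \<Gamma>) \<subseteq> sets (path_space b)"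
    unfolding sets_coord_algebra by (intro sets.sigma_sets_subset) auto
  then show ?thesis
    using sets_eq_imp_space_eq[OF assms(1)] by (simp add: subalgebra_def assms(1))
qed

lemma measurable_coordinate:
  assumes "\<gamma> \<in> \<Gamma>" "\<Gamma> \<subseteq> tree_words b"
  shows "(\<lambda>\<omega>. \<omega> \<gamma>) \<in> coord_algebra b \<Gamma> \<rightarrow>\<^sub>M nonneg_borel"
proof (rule measurableI)
  fix A assume "A \<in> sets nonneg_borel"
  then show "(\<lambda>\<omega>. \<omega> \<gamma>) -` A \<inter> space (coord_algebra b \<Gamma>) \<in> sets (coord_algebra b \<Gamma>)"
    unfolding sets_coord_algebra using assms(1)
    by (intro sigma_sets.Basic) (auto simp: vimage_def)
next
  fix \<omega> assume "\<omega> \<in> space (coord_algebra b \<Gamma>)"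
  then show "\<omega> \<gamma> \<in> space nonneg_borel"
    using assms by (auto simp: path_space_def space_PiM)
qed

lemma borel_measurable_nonneg_borel: "f \<in> N \<rightarrow>\<^sub>M nonneg_borel \<Longrightarrow> f \<in> borel_measurable N"
  unfolding nonneg_borel_def by (rule measurable_restrict_space2_iff[THEN iffD1, THEN conjunct1])

lemma borel_measurable_coordinate:
  "\<gamma> \<in> \<Gamma> \<Longrightarrow> \<Gamma> \<subseteq> tree_words b \<Longrightarrow> (\<lambda>\<omega>. \<omega> \<gamma>) \<in> borel_measurable (coord_algebra b \<Gamma>)"
  by (intro borel_measurable_nonneg_borel measurable_coordinate)

text \<open>Adjoining one coordinate: the rectangles on the right are closed under intersection, which is what
  lets identities of integrals be verified one coordinate at a time.\<close>
lemma sets_coord_algebra_insert: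
  assumes "insert \<gamma> \<Gamma> \<subseteq> tree_words b"
  shows "sets (coord_algebra b (insert \<gamma> \<Gamma>)) = sigma_sets (space (path_space b))
     {B \<inter> {\<omega> \<in> space (path_space b). \<omega> \<gamma> \<in> A} | B A. B \<in> sets (coord_algebra b \<Gamma>) \<and> A \<in> sets nonneg_borel}"
    (is "_ = sigma_sets ?\<Omega> ?R")
proof
  have sp: "?\<Omega> = {\<omega> \<in> ?\<Omega>. \<omega> \<gamma> \<in> space nonneg_borel}"
    using assms by (auto simp: path_space_def space_PiM)
  have top: "?\<Omega> \<in> sets (coord_algebra b \<Gamma>)"
    using sets.top[of "coord_algebra b \<Gamma>"] by simp
  show "sets (coord_algebra b (insert \<gamma> \<Gamma>)) \<subseteq> sigma_sets ?\<Omega> ?R"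
    unfolding sets_coord_algebra[of b "insert \<gamma> \<Gamma>"]
  proof (rule sigma_sets_mono, rule subsetI)
    fix X assume "X \<in> {{\<omega> \<in> ?\<Omega>. \<omega> \<delta> \<in> A} | \<delta> A. \<delta> \<in> insert \<gamma> \<Gamma> \<and> A \<in> sets nonneg_borel}"
    then obtain \<delta> A where X: "X = {\<omega> \<in> ?\<Omega>. \<omega> \<delta> \<in> A}" and \<delta>: "\<delta> \<in> insert \<gamma> \<Gamma>" and A: "A \<in> sets nonneg_borel"
      by blast
    have "X \<in> ?R"
    proof (cases "\<delta> = \<gamma>")
      case True
      then have "X = ?\<Omega> \<inter> {\<omega> \<in> ?\<Omega>. \<omega> \<gamma> \<in> A}" unfolding X by auto
      then show ?thesis using top A by blast
    next
      case False
      then have "X \<in> sets (coord_algebra b \<Gamma>)"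
        using \<delta> A unfolding sets_coord_algebra X by (intro sigma_sets.Basic) auto
      moreover have "X = X \<inter> {\<omega> \<in> ?\<Omega>. \<omega> \<gamma> \<in> space nonneg_borel}"
        using sp unfolding X by blast
      ultimately show ?thesis using sets.top[of nonneg_borel] by blast
    qed
    then show "X \<in> sigma_sets ?\<Omega> ?R" by (rule sigma_sets.Basic)
  qed
  have "B \<inter> {\<omega> \<in> ?\<Omega>. \<omega> \<gamma> \<in> A} \<in> sets (coord_algebra b (insert \<gamma> \<Gamma>))"
    if "B \<in> sets (coord_algebra b \<Gamma>)" "A \<in> sets nonneg_borel" for A B
  proof (rule sets.Int)
    show "B \<in> sets (coord_algebra b (insert \<gamma> \<Gamma>))"
      using that sets_coord_algebra_mono[of \<Gamma> "insert \<gamma> \<Gamma>" b] by auto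
    show "{\<omega> \<in> ?\<Omega>. \<omega> \<gamma> \<in> A} \<in> sets (coord_algebra b (insert \<gamma> \<Gamma>))"
      using that unfolding sets_coord_algebra by (intro sigma_sets.Basic) auto
  qed
  then have "?R \<subseteq> sets (coord_algebra b (insert \<gamma> \<Gamma>))" by auto
  from sets.sigma_sets_subset[OF this]
  show "sigma_sets ?\<Omega> ?R \<subseteq> sets (coord_algebra b (insert \<gamma> \<Gamma>))" by simp
qed

lemma sets_coord_algebra_UN:
  fixes \<Gamma> :: "nat \<Rightarrow> nat list set"
  shows "sets (coord_algebra b (\<Union>N. \<Gamma> N)) =
    sigma_sets (space (path_space b)) (\<Union>N. sets (coord_algebra b (\<Gamma> N)))"
proof
  show "sets (coord_algebra b (\<Union>N. \<Gamma> N)) \<subseteq>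
    sigma_sets (space (path_space b)) (\<Union>N. sets (coord_algebra b (\<Gamma> N)))"
    unfolding sets_coord_algebra[of b "\<Union>N. \<Gamma> N"]
  proof (rule sigma_sets_mono, safe)
    fix \<gamma> A N assume "\<gamma> \<in> \<Gamma> N" "A \<in> sets nonneg_borel"
    then have "{\<omega> \<in> space (path_space b). \<omega> \<gamma> \<in> A} \<in> sets (coord_algebra b (\<Gamma> N))"
      unfolding sets_coord_algebra by (intro sigma_sets.Basic) auto
    then show "{\<omega> \<in> space (path_space b). \<omega> \<gamma> \<in> A} \<in>
        sigma_sets (space (path_space b)) (\<Union>N. sets (coord_algebra b (\<Gamma> N)))"
      by (intro sigma_sets.Basic) auto
  qed
  have "(\<Union>N. sets (coord_algebra b (\<Gamma> N))) \<subseteq> sets (coord_algebra b (\<Union>N. \<Gamma> N))"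
    by (intro UN_least sets_coord_algebra_mono) auto
  from sets.sigma_sets_subset[OF this]
  show "sigma_sets (space (path_space b)) (\<Union>N. sets (coord_algebra b (\<Gamma> N))) \<subseteq>
      sets (coord_algebra b (\<Union>N. \<Gamma> N))" by simp
qed

lemma Int_stable_directed_coord_algebras:
  fixes \<Gamma> :: "nat \<Rightarrow> nat list set"
  assumes "mono \<Gamma>"
  shows "Int_stable (\<Union>N. sets (coord_algebra b (\<Gamma> N)))"
proof (rule Int_stableI, safe)
  fix A B m n assume "A \<in> sets (coord_algebra b (\<Gamma> m))" "B \<in> sets (coord_algebra b (\<Gamma> n))"
  moreover have "\<Gamma> m \<subseteq> \<Gamma> (max m n)" "\<Gamma> n \<subseteq> \<Gamma> (max m n)"
    using monoD[OF assms, of m "max m n"] monoD[OF assms, of n "max m n"] by simp_all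
  ultimately have "A \<inter> B \<in> sets (coord_algebra b (\<Gamma> (max m n)))"
    using sets_coord_algebra_mono by (meson sets.Int subsetD)
  then show "A \<inter> B \<in> (\<Union>N. sets (coord_algebra b (\<Gamma> N)))" by blast
qed

section \<open>Integrals against test functions of a sub-sigma-algebra\<close>

text \<open>The pi-lambda argument for two densities. The sets \<open>C i\<close> exhaust the space with finite
  \<open>f1\<close>-integral, so that \<open>f1\<close> itself may have infinite integral; this is needed under the spine law.\<close>
lemma nn_integral_eq_on_generated:
  assumes sub: "subalgebra M G" and gen: "sets G = sigma_sets (space M) E" and E: "Int_stable E" "E \<subseteq> Pow (space M)"
    and f [measurable]: "f1 \<in> borel_measurable M" "f2 \<in> borel_measurable M"
    and eq: "\<And>X. X \<in> E \<Longrightarrow> (\<integral>\<^sup>+ x. f1 x * indicator X x \<partial>M) = (\<integral>\<^sup>+ x. f2 x * indicator X x \<partial>M)"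
    and C: "range C \<subseteq> E" "(\<Union>i. C i) = space M" "\<And>i::nat. (\<integral>\<^sup>+ x. f1 x * indicator (C i) x \<partial>M) < \<infinity>"
    and g: "g \<in> borel_measurable G"
  shows "(\<integral>\<^sup>+ x. f1 x * g x \<partial>M) = (\<integral>\<^sup>+ x. f2 x * g x \<partial>M)"
proof -
  let ?R = "\<lambda>f. restr_to_subalg (density M f) G"
  have sub': "subalgebra (density M f) G" for f
    using sub by (simp add: subalgebra_def)
  have EM: "X \<in> sets G" if "X \<in> E" for X
    using that gen by auto
  then have EM': "X \<in> sets M" if "X \<in> E" for X
    using that sub by (auto simp: subalgebra_def)
  have em: "emeasure (?R f) X = (\<integral>\<^sup>+ x. f x * indicator X x \<partial>M)" if "X \<in> E" "f \<in> borel_measurable M" for X f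
    using that EM EM' by (simp add: emeasure_restr_to_subalg[OF sub'] emeasure_density)
  have "?R f1 = ?R f2"
  proof (rule measure_eqI_generator_eq[OF E])
    show "emeasure (?R f1) X = emeasure (?R f2) X" if "X \<in> E" for X
      using that eq by (simp add: em f)
    show "emeasure (?R f1) (C i) \<noteq> \<infinity>" for i
      using C(1) C(3)[of i] by (subst em) (auto simp: f)
  qed (use C in \<open>simp_all add: gen sets_restr_to_subalg[OF sub']\<close>)
  then have "(\<integral>\<^sup>+ x. g x \<partial>density M f1) = (\<integral>\<^sup>+ x. g x \<partial>density M f2)"
    using nn_integral_subalgebra2[OF sub' g] by metis
  moreover have "g \<in> borel_measurable M" using measurable_from_subalg[OF sub g] .
  ultimately show ?thesis by (simp add: nn_integral_density)
qed

lemma nn_integral_eq_on_insert_coordinate: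
  assumes M: "sets M = sets (path_space b)" and \<Gamma>: "insert \<gamma> \<Gamma> \<subseteq> tree_words b"
    and f [measurable]: "f1 \<in> borel_measurable M" "f2 \<in> borel_measurable M"
    and fin: "(\<integral>\<^sup>+ \<omega>. f1 \<omega> \<partial>M) < \<infinity>"
    and eq: "\<And>B A. B \<in> sets (coord_algebra b \<Gamma>) \<Longrightarrow> A \<in> sets nonneg_borel \<Longrightarrow>
      (\<integral>\<^sup>+ \<omega>. f1 \<omega> * (indicator B \<omega> * indicator A (\<omega> \<gamma>)) \<partial>M) =
      (\<integral>\<^sup>+ \<omega>. f2 \<omega> * (indicator B \<omega> * indicator A (\<omega> \<gamma>)) \<partial>M)"
    and g: "g \<in> borel_measurable (coord_algebra b (insert \<gamma> \<Gamma>))"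
  shows "(\<integral>\<^sup>+ \<omega>. f1 \<omega> * g \<omega> \<partial>M) = (\<integral>\<^sup>+ \<omega>. f2 \<omega> * g \<omega> \<partial>M)"
proof (rule nn_integral_eq_on_generated[OF subalgebra_coord_algebra[OF M \<Gamma>] _ _ _ f _ _ _ _ g])
  let ?\<Omega> = "space (path_space b)"
  have sp: "space M = ?\<Omega>" using M by (rule sets_eq_imp_space_eq)
  let ?R = "{B \<inter> {\<omega> \<in> ?\<Omega>. \<omega> \<gamma> \<in> A} | B A. B \<in> sets (coord_algebra b \<Gamma>) \<and> A \<in> sets nonneg_borel}"
  show "sets (coord_algebra b (insert \<gamma> \<Gamma>)) = sigma_sets (space M) ?R"
    unfolding sp by (rule sets_coord_algebra_insert[OF \<Gamma>])
  show "Int_stable ?R"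
  proof (rule Int_stableI, safe)
    fix B A B' A' assume "B \<in> sets (coord_algebra b \<Gamma>)" "B' \<in> sets (coord_algebra b \<Gamma>)"
      "A \<in> sets nonneg_borel" "A' \<in> sets nonneg_borel"
    then have *: "B \<inter> B' \<in> sets (coord_algebra b \<Gamma>)" "A \<inter> A' \<in> sets nonneg_borel" by auto
    show "\<exists>C D. B \<inter> {\<omega> \<in> ?\<Omega>. \<omega> \<gamma> \<in> A} \<inter> (B' \<inter> {\<omega> \<in> ?\<Omega>. \<omega> \<gamma> \<in> A'}) = C \<inter> {\<omega> \<in> ?\<Omega>. \<omega> \<gamma> \<in> D} \<and>
        C \<in> sets (coord_algebra b \<Gamma>) \<and> D \<in> sets nonneg_borel"
      by (rule exI[of _ "B \<inter> B'"], rule exI[of _ "A \<inter> A'"]) (use * in auto)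
  qed
  show "?R \<subseteq> Pow (space M)" unfolding sp by auto
  show "(\<integral>\<^sup>+ x. f1 x * indicator X x \<partial>M) = (\<integral>\<^sup>+ x. f2 x * indicator X x \<partial>M)" if X: "X \<in> ?R" for X
  proof -
    obtain B A where X: "X = B \<inter> {\<omega> \<in> ?\<Omega>. \<omega> \<gamma> \<in> A}" "B \<in> sets (coord_algebra b \<Gamma>)" "A \<in> sets nonneg_borel"
      using X by auto
    have "indicator X \<omega> = (indicator B \<omega> * indicator A (\<omega> \<gamma>) :: ennreal)" if "\<omega> \<in> space M" for \<omega>
      using that X(1) sp by (auto simp: indicator_def)
    then have "(\<integral>\<^sup>+ x. f x * indicator X x \<partial>M) = (\<integral>\<^sup>+ \<omega>. f \<omega> * (indicator B \<omega> * indicator A (\<omega> \<gamma>)) \<partial>M)" for f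
      by (intro nn_integral_cong) simp
    then show ?thesis using eq[OF X(2,3)] by simp
  qed
  have "?\<Omega> = ?\<Omega> \<inter> {\<omega> \<in> ?\<Omega>. \<omega> \<gamma> \<in> space nonneg_borel}"
    using \<Gamma> by (auto simp: path_space_def space_PiM)
  moreover have "?\<Omega> \<in> sets (coord_algebra b \<Gamma>)"
    using sets.top[of "coord_algebra b \<Gamma>"] by simp
  ultimately show "range (\<lambda>_::nat. space M) \<subseteq> ?R" unfolding sp using sets.top[of nonneg_borel] by blast
  show "(\<integral>\<^sup>+ x. f1 x * indicator (space M) x \<partial>M) < \<infinity>"
    using fin by (simp cong: nn_integral_cong)
qed simp

section \<open>Vertex weights and the pathwise bounds\<close>

definition vertex_weight ::
  "(nat list \<Rightarrow> (nat list \<Rightarrow> real) \<Rightarrow> real) \<Rightarrow> nat list \<Rightarrow> (nat list \<Rightarrow> real) \<Rightarrow> real" where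
  "vertex_weight F \<gamma> \<omega> = (\<Prod>i\<le>length \<gamma>. \<omega> (take i \<gamma>)) * F \<gamma> \<omega>"

text \<open>The factors of a vertex weight strictly below the vertex \<open>v\<close>.\<close>
definition branch_weight ::
  "(nat list \<Rightarrow> (nat list \<Rightarrow> real) \<Rightarrow> real) \<Rightarrow> nat list \<Rightarrow> nat list \<Rightarrow> (nat list \<Rightarrow> real) \<Rightarrow> real" where
  "branch_weight F v \<gamma> \<omega> = (\<Prod>i=1..length \<gamma>. \<omega> (v @ take i \<gamma>)) * F (v @ \<gamma>) \<omega>"

definition branches_off :: "nat \<Rightarrow> nat \<Rightarrow> nat \<Rightarrow> nat list set" where
  "branches_off b a k = {\<gamma> \<in> level_words b k. hd \<gamma> \<noteq> a}"

lemma finite_branches_off: "finite (branches_off b a k)"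
  using finite_level_words[of b k] by (simp add: branches_off_def)

lemma weighted_density_eq: "weighted_density F n t \<omega> = vertex_weight F (prefix_of t n) \<omega>"
  unfolding weighted_density_def vertex_weight_def path_weight_def
  by (auto intro!: prod.cong arg_cong2[where f="(*)"] simp: min_def)

lemma vertex_weight_append:
  "vertex_weight F (v @ \<gamma>) \<omega> = (\<Prod>i\<le>length v. \<omega> (take i v)) * branch_weight F v \<gamma> \<omega>"
proof -
  have "(\<Prod>i\<le>length v + k. \<omega> (take i (v @ \<gamma>))) =
      (\<Prod>i\<le>length v. \<omega> (take i v)) * (\<Prod>i=1..k. \<omega> (v @ take i \<gamma>))" for k
    by (induction k) (simp_all add: atMost_Suc mult.commute mult.left_commute)
  from this[of "length \<gamma>"] show ?thesis
    by (simp add: vertex_weight_def branch_weight_def mult.assoc)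
qed

lemma vertex_weight_spine_append:
  "vertex_weight F (prefix_of t j @ \<gamma>) \<omega> = path_weight t j \<omega> * branch_weight F (prefix_of t j) \<gamma> \<omega>"
  unfolding vertex_weight_append path_weight_def
  by (auto intro!: prod.cong arg_cong2[where f="(*)"] simp: min_def)

lemma off_spine_sum_eq:
  "off_spine_sum b F c t n \<omega> = (\<Sum>j<n. \<Sum>\<gamma>\<in>branches_off b (t j) (n - j).
     c j \<omega> t * (1 / real b) ^ (n - j) * branch_weight F (prefix_of t j) \<gamma> \<omega>)"
proof -
  have "(\<Sum>\<gamma> | \<gamma> \<in> tree_words b \<and> length \<gamma> = n - j \<and> hd \<gamma> \<noteq> t j.
           (\<Prod>i=1..n - j. \<omega> (prefix_of t j @ take i \<gamma>)) * F (prefix_of t j @ \<gamma>) \<omega>) =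
        (\<Sum>\<gamma>\<in>branches_off b (t j) (n - j). branch_weight F (prefix_of t j) \<gamma> \<omega>)" for j
    by (intro sum.cong) (auto simp: branches_off_def level_words_def branch_weight_def)
  then show ?thesis
    unfolding off_spine_sum_def by (simp add: sum_distrib_left)
qed

lemma append_in_tree_words [simp]: "v @ \<gamma> \<in> tree_words b \<longleftrightarrow> v \<in> tree_words b \<and> \<gamma> \<in> tree_words b"
  by (auto simp: tree_words_def)

lemma path_weight_nonneg:
  "\<omega> \<in> space (path_space b) \<Longrightarrow> t \<in> space (haar b) \<Longrightarrow> 0 \<le> path_weight t n \<omega>"
  unfolding path_weight_def
  by (intro prod_nonneg) (auto intro: space_path_space_nonneg prefix_of_in_tree_words)

lemma vertex_weight_nonneg:
  assumes "\<And>\<gamma>. \<gamma> \<in> tree_words b \<Longrightarrow> 0 \<le> F \<gamma> \<omega>" "\<omega> \<in> space (path_space b)" "\<gamma> \<in> tree_words b"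
  shows "0 \<le> vertex_weight F \<gamma> \<omega>"
  unfolding vertex_weight_def using assms
  by (intro mult_nonneg_nonneg prod_nonneg) (auto intro: space_path_space_nonneg take_in_tree_words)

lemma branch_weight_nonneg:
  assumes "\<And>\<gamma>. \<gamma> \<in> tree_words b \<Longrightarrow> 0 \<le> F \<gamma> \<omega>" "\<omega> \<in> space (path_space b)"
    "v \<in> tree_words b" "\<gamma> \<in> tree_words b"
  shows "0 \<le> branch_weight F v \<gamma> \<omega>"
  unfolding branch_weight_def using assms
  by (intro mult_nonneg_nonneg prod_nonneg) (auto intro!: space_path_space_nonneg simp: take_in_tree_words)

lemma measurable_prefix: "0 < b \<Longrightarrow> (\<lambda>t. prefix_of t n) \<in> haar b \<rightarrow>\<^sub>M count_space (level_words b n)"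
  using cylinder_sets[of b _ n]
  by (subst measurable_count_space_eq2)
    (auto simp: finite_level_words prefix_of_in_level_words vimage_def Int_def conj_commute)

lemma total_mass:
  assumes "0 < b"
  shows "emeasure (cascade_measure b F n \<omega>) (space (haar b)) =
    (\<Sum>\<gamma>\<in>level_words b n. ennreal (vertex_weight F \<gamma> \<omega>) * ennreal ((1 / real b) ^ n))"
proof -
  have "(\<lambda>t. ennreal (vertex_weight F (prefix_of t n) \<omega>)) \<in> borel_measurable (haar b)"
    by (rule measurable_compose[OF measurable_prefix[OF assms]]) simp
  then have "emeasure (cascade_measure b F n \<omega>) (space (haar b)) =
      (\<integral>\<^sup>+ t. ennreal (vertex_weight F (prefix_of t n) \<omega>) \<partial>haar b)"
    unfolding cascade_measure_def weighted_density_eq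
    by (subst emeasure_density) (auto cong: nn_integral_cong)
  then show ?thesis
    using nn_integral_prefix[OF assms, of "\<lambda>\<gamma>. ennreal (vertex_weight F \<gamma> \<omega>)"] by simp
qed

lemma sum_level_le_spine_plus_branches:
  fixes g :: "nat list \<Rightarrow> ennreal"
  assumes "t \<in> space (haar b)"
  shows "(\<Sum>\<gamma>\<in>level_words b n. g \<gamma>) \<le>
    g (prefix_of t n) + (\<Sum>j<n. \<Sum>\<gamma>\<in>branches_off b (t j) (n - j). g (prefix_of t j @ \<gamma>))"
proof -
  have "(\<Sum>\<gamma>\<in>level_words b n. g \<gamma>) =
      g (prefix_of t n) + (\<Sum>\<gamma>\<in>level_words b n - {prefix_of t n}. g \<gamma>)"
    using assms by (intro sum.remove finite_level_words prefix_of_in_level_words)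
  also have "(\<Sum>\<gamma>\<in>level_words b n - {prefix_of t n}. g \<gamma>) \<le>
      (\<Sum>(j, \<gamma>)\<in>Sigma {..<n} (\<lambda>j. branches_off b (t j) (n - j)). g (prefix_of t j @ \<gamma>))"
  proof (rule sum_le_included[where i="\<lambda>(j, \<gamma>). prefix_of t j @ \<gamma>"])
    show "\<forall>\<gamma>\<in>level_words b n - {prefix_of t n}.
        \<exists>y\<in>Sigma {..<n} (\<lambda>j. branches_off b (t j) (n - j)). (case y of (j, \<gamma>) \<Rightarrow> prefix_of t j @ \<gamma>) = \<gamma> \<and>
          g \<gamma> \<le> (case y of (j, \<gamma>) \<Rightarrow> g (prefix_of t j @ \<gamma>))"
    proof
      fix \<gamma> assume "\<gamma> \<in> level_words b n - {prefix_of t n}"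
      then obtain j \<gamma>' where "j < n" "\<gamma>' \<in> level_words b (n - j)" "hd \<gamma>' \<noteq> t j" "\<gamma> = prefix_of t j @ \<gamma>'"
        using first_divergence[of \<gamma> b n t] by auto
      then show "\<exists>y\<in>Sigma {..<n} (\<lambda>j. branches_off b (t j) (n - j)). (case y of (j, \<gamma>) \<Rightarrow> prefix_of t j @ \<gamma>) = \<gamma> \<and>
          g \<gamma> \<le> (case y of (j, \<gamma>) \<Rightarrow> g (prefix_of t j @ \<gamma>))"
        by (intro bexI[of _ "(j, \<gamma>')"]) (auto simp: branches_off_def)
    qed
  qed (auto simp: finite_level_words finite_branches_off)
  also have "\<dots> = (\<Sum>j<n. \<Sum>\<gamma>\<in>branches_off b (t j) (n - j). g (prefix_of t j @ \<gamma>))"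
    by (rule sum.Sigma[symmetric]) (auto simp: finite_branches_off)
  finally show ?thesis by (simp add: add_mono)
qed

text \<open>Division by zero is harmless here: a finite quotient \<open>x / 0\<close> forces \<open>x = 0\<close>.\<close>
lemma le_mult_of_divide_le_ennreal:
  fixes x S :: ennreal
  assumes "x / ennreal c \<le> S" "S \<noteq> \<infinity>" "x \<noteq> \<infinity>"
  shows "x \<le> S * ennreal c"
proof (cases "ennreal c = 0")
  case True
  then have "x = 0" using assms by (auto simp: ennreal_divide_zero top_unique split: if_splits)
  then show ?thesis by simp
next
  case False
  then have "x = x / ennreal c * ennreal c"
    by (simp add: ennreal_divide_times ennreal_mult_divide_eq)
  also have "\<dots> \<le> S * ennreal c" using assms(1) by (intro mult_right_mono) auto
  finally show ?thesis .
qed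

lemma total_mass_bounds:
  assumes b: "0 < b" and t: "t \<in> space (haar b)" and \<omega>: "\<omega> \<in> space (path_space b)"
    and F: "\<And>\<gamma>. \<gamma> \<in> tree_words b \<Longrightarrow> 0 \<le> F \<gamma> \<omega>"
    and c: "\<And>j. 0 \<le> c j \<omega> t"
  shows "ennreal ((1 / real b) ^ n * path_weight t n \<omega> * F (prefix_of t n) \<omega>)
          \<le> emeasure (cascade_measure b F n \<omega>) (space (haar b))" (is "?L \<le> ?m")
    and "emeasure (cascade_measure b F n \<omega>) (space (haar b))
          \<le> ennreal ((1 / real b) ^ n * path_weight t n \<omega> * F (prefix_of t n) \<omega>)
            + times_top (spine_sup b c t \<omega>) (ennreal (off_spine_sum b F c t n \<omega>))"
proof -
  let ?g = "\<lambda>\<gamma>. ennreal (vertex_weight F \<gamma> \<omega>) * ennreal ((1 / real b) ^ n)"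
  have spine: "?g (prefix_of t n) = ?L"
    using path_weight_nonneg[OF \<omega> t, of n] F[OF prefix_of_in_tree_words[OF t]]
    by (subst ennreal_mult'[symmetric])
      (simp_all add: weighted_density_eq[symmetric] weighted_density_def mult_ac)
  have "?g (prefix_of t n) \<le> sum ?g (level_words b n)"
    using t by (intro member_le_sum finite_level_words prefix_of_in_level_words) auto
  then show "?L \<le> ?m" unfolding spine total_mass[OF b] .
  show "?m \<le> ?L + times_top (spine_sup b c t \<omega>) (ennreal (off_spine_sum b F c t n \<omega>))"
  proof (cases "spine_sup b c t \<omega> = \<infinity>")
    case True
    then show ?thesis by (simp add: times_top_def)
  next
    case fin: False
    let ?S = "spine_sup b c t \<omega>"
    let ?a = "\<lambda>j \<gamma>. c j \<omega> t * (1 / real b) ^ (n - j) * branch_weight F (prefix_of t j) \<gamma> \<omega>"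
    have branch: "0 \<le> branch_weight F (prefix_of t j) \<gamma> \<omega>" if "\<gamma> \<in> branches_off b (t j) (n - j)" for j \<gamma>
      using that t \<omega> F
      by (intro branch_weight_nonneg[where b=b]) (auto simp: branches_off_def level_words_def prefix_of_in_tree_words)
    then have a: "0 \<le> ?a j \<gamma>" if "\<gamma> \<in> branches_off b (t j) (n - j)" for j \<gamma>
      using that c by simp
    \<comment> \<open>The weight splits at the vertex where \<open>\<gamma>\<close> leaves the ray; only the part above it is compared with \<open>c\<close>.\<close>
    have le: "?g (prefix_of t j @ \<gamma>) \<le> ?S * ennreal (?a j \<gamma>)"
      if j: "j < n" and \<gamma>: "\<gamma> \<in> branches_off b (t j) (n - j)" for j \<gamma>
    proof -
      have "ennreal ((1 / real b) ^ j * path_weight t j \<omega>) / ennreal (c j \<omega> t) \<le> ?S"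
        unfolding spine_sup_def by (rule SUP_upper) simp
      then have *: "ennreal ((1 / real b) ^ j * path_weight t j \<omega>) \<le> ?S * ennreal (c j \<omega> t)"
        using fin by (intro le_mult_of_divide_le_ennreal) auto
      have "(1 / real b) ^ n = (1 / real b) ^ j * (1 / real b) ^ (n - j)"
        using j by (simp flip: power_add)
      then have "?g (prefix_of t j @ \<gamma>) =
          ennreal ((1 / real b) ^ j * path_weight t j \<omega>) *
          ennreal ((1 / real b) ^ (n - j) * branch_weight F (prefix_of t j) \<gamma> \<omega>)"
        using branch[OF \<gamma>] path_weight_nonneg[OF \<omega> t, of j]
        by (simp add: vertex_weight_spine_append mult_ac flip: ennreal_mult)
      also have "\<dots> \<le> ?S * ennreal (c j \<omega> t) *
          ennreal ((1 / real b) ^ (n - j) * branch_weight F (prefix_of t j) \<gamma> \<omega>)"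
        by (intro mult_right_mono *) simp
      also have "\<dots> = ?S * ennreal (?a j \<gamma>)"
        using branch[OF \<gamma>] c by (simp add: mult.assoc flip: ennreal_mult)
      finally show ?thesis .
    qed
    have "?m \<le> ?g (prefix_of t n) + (\<Sum>j<n. \<Sum>\<gamma>\<in>branches_off b (t j) (n - j). ?g (prefix_of t j @ \<gamma>))"
      unfolding total_mass[OF b] by (rule sum_level_le_spine_plus_branches[OF t])
    also have "\<dots> \<le> ?L + (\<Sum>j<n. \<Sum>\<gamma>\<in>branches_off b (t j) (n - j). ?S * ennreal (?a j \<gamma>))"
      unfolding spine by (intro add_left_mono sum_mono le) auto
    also have "(\<Sum>j<n. \<Sum>\<gamma>\<in>branches_off b (t j) (n - j). ?S * ennreal (?a j \<gamma>)) =
        ?S * (\<Sum>j<n. \<Sum>\<gamma>\<in>branches_off b (t j) (n - j). ennreal (?a j \<gamma>))"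
      by (simp add: sum_distrib_left)
    also have "(\<Sum>j<n. \<Sum>\<gamma>\<in>branches_off b (t j) (n - j). ennreal (?a j \<gamma>)) =
        ennreal (off_spine_sum b F c t n \<omega>)"
      unfolding off_spine_sum_eq using a by (simp add: sum_ennreal sum_nonneg)
    finally show ?thesis using fin by (simp add: times_top_def)
  qed
qed

section \<open>One-step conditional means under the cascade law\<close>

text \<open>The hypotheses on the cascade use real conditional expectations, the computations below use those
  with values in \<open>[0,\<infinity>]\<close>; integrability makes the latter finite almost everywhere, so they agree.\<close>
lemma (in sigma_finite_subalgebra) ennreal_real_cond_exp:
  assumes f: "integrable M f" and nonneg: "\<And>x. x \<in> space M \<Longrightarrow> 0 \<le> f x"
  shows "AE x in M. ennreal (real_cond_exp M F f x) = nn_cond_exp M F (\<lambda>x. ennreal (f x)) x"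
proof -
  have [measurable]: "f \<in> borel_measurable M" using f by simp
  have "AE x in M. nn_cond_exp M F (\<lambda>x. ennreal (- f x)) x = nn_cond_exp M F (\<lambda>_. 0) x"
    using nonneg by (intro nn_cond_exp_cong AE_I2) (auto simp: ennreal_neg)
  moreover have "AE x in M. 0 = nn_cond_exp M F (\<lambda>_. 0) x"
    using nn_cond_exp_F_meas[of "\<lambda>_. 0"] by simp
  ultimately have neg: "AE x in M. nn_cond_exp M F (\<lambda>x. ennreal (- f x)) x = 0"
    by eventually_elim simp
  have "(\<integral>\<^sup>+ x. nn_cond_exp M F (\<lambda>x. ennreal (f x)) x \<partial>M) = (\<integral>\<^sup>+ x. ennreal (f x) \<partial>M)"
    using nn_cond_exp_intg[of "\<lambda>_. 1" "\<lambda>x. ennreal (f x)"] by simp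
  also have "\<dots> < \<infinity>"
    using f nonneg by (simp add: integrable_iff_bounded cong: nn_integral_cong)
  finally have "AE x in M. nn_cond_exp M F (\<lambda>x. ennreal (f x)) x \<noteq> \<infinity>"
    by (intro nn_integral_PInf_AE) auto
  with neg show ?thesis
    by eventually_elim (simp add: real_cond_exp_def less_top)
qed

definition words_upto :: "nat \<Rightarrow> nat \<Rightarrow> nat list set" where
  "words_upto b n = {\<gamma> \<in> tree_words b. length \<gamma> \<le> n}"

text \<open>The vertices that a test function may read after the spine has been revealed down to level
  \<open>N\<close>, the rest of the tree down to level \<open>n\<close>.\<close>
definition trunk :: "nat \<Rightarrow> (nat \<Rightarrow> nat) \<Rightarrow> nat \<Rightarrow> nat \<Rightarrow> nat list set" where
  "trunk b t n N = words_upto b n \<union> prefix_of t ` {..N}"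

lemma level_algebra_eq: "level_algebra b n = coord_algebra b (words_upto b n)"
  by (simp add: level_algebra_def words_upto_def)

lemma words_upto_subset: "words_upto b n \<subseteq> tree_words b"
  by (auto simp: words_upto_def)

lemma words_upto_mono: "m \<le> n \<Longrightarrow> words_upto b m \<subseteq> words_upto b n"
  by (auto simp: words_upto_def)

lemma trunk_subset: "t \<in> space (haar b) \<Longrightarrow> trunk b t n N \<subseteq> tree_words b"
  by (auto simp: trunk_def prefix_of_in_tree_words words_upto_def)

lemma trunk_Suc: "trunk b t n (Suc N) = insert (prefix_of t (Suc N)) (trunk b t n N)"
  by (auto simp: trunk_def atMost_Suc)

lemma trunk_le_level: "t \<in> space (haar b) \<Longrightarrow> n \<le> N \<Longrightarrow> trunk b t n N \<subseteq> words_upto b N"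
  by (auto simp: trunk_def prefix_of_in_tree_words words_upto_def)

lemma trunk_base: "t \<in> space (haar b) \<Longrightarrow> trunk b t n n = words_upto b n"
  by (auto simp: trunk_def prefix_of_in_tree_words words_upto_def)

lemma spine_algebra_eq: "spine_algebra b t n = coord_algebra b (range (prefix_of t) \<union> words_upto b n)"
  by (simp add: spine_algebra_def words_upto_def)

lemma spine_vertices_subset: "t \<in> space (haar b) \<Longrightarrow> range (prefix_of t) \<union> words_upto b n \<subseteq> tree_words b"
  by (auto simp: prefix_of_in_tree_words words_upto_def)

locale weighted_cascade =
  fixes b p0 q P F
  assumes b2: "2 \<le> b" and generator: "cascade_generator b p0 q P" and weights: "weight_system b P F"
begin

lemma b_pos: "0 < b" using b2 by simp

sublocale P: prob_space P
  using generator by (simp add: cascade_generator_def)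

lemma sets_P: "sets P = sets (path_space b)"
  using generator by (simp add: cascade_generator_def)

lemma space_P: "space P = space (path_space b)"
  using sets_P by (rule sets_eq_imp_space_eq)

lemma F_nonneg: "\<gamma> \<in> tree_words b \<Longrightarrow> \<omega> \<in> space (path_space b) \<Longrightarrow> 0 \<le> F \<gamma> \<omega>"
  using weights by (auto simp: weight_system_def)

lemma measurable_F:
  assumes "\<gamma> \<in> tree_words b" "\<And>j. take j \<gamma> \<in> \<Gamma>"
  shows "F \<gamma> \<in> borel_measurable (coord_algebra b \<Gamma>)"
proof (rule measurable_coord_algebra_mono)
  show "F \<gamma> \<in> borel_measurable (coord_algebra b {take j \<gamma> | j. j \<le> length \<gamma>})"
    using weights assms(1) unfolding weight_system_def by blast
qed (use assms in auto)

lemma measurable_vertex_weight: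
  assumes \<gamma>: "\<gamma> \<in> tree_words b" "\<And>j. take j \<gamma> \<in> \<Gamma>" and \<Gamma>: "\<Gamma> \<subseteq> tree_words b"
  shows "vertex_weight F \<gamma> \<in> borel_measurable (coord_algebra b \<Gamma>)"
proof -
  have [measurable]: "(\<lambda>\<omega>. \<omega> (take i \<gamma>)) \<in> borel_measurable (coord_algebra b \<Gamma>)" for i
    using \<gamma>(2) \<Gamma> by (rule borel_measurable_coordinate)
  have [measurable]: "F \<gamma> \<in> borel_measurable (coord_algebra b \<Gamma>)"
    using \<gamma> by (rule measurable_F)
  show ?thesis unfolding vertex_weight_def[abs_def] by measurable
qed

lemma vertex_weight_nonneg_on_paths: "\<gamma> \<in> tree_words b \<Longrightarrow> \<omega> \<in> space (path_space b) \<Longrightarrow> 0 \<le> vertex_weight F \<gamma> \<omega>"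
  by (rule vertex_weight_nonneg) (auto intro: F_nonneg)

lemma measurable_vertex_weight_level:
  assumes "\<gamma> \<in> tree_words b" "length \<gamma> \<le> n"
  shows "vertex_weight F \<gamma> \<in> borel_measurable (coord_algebra b (words_upto b n))"
  using assms by (intro measurable_vertex_weight words_upto_subset)
    (auto simp: words_upto_def take_in_tree_words)

lemma measurable_P:
  "f \<in> coord_algebra b \<Gamma> \<rightarrow>\<^sub>M N \<Longrightarrow> \<Gamma> \<subseteq> tree_words b \<Longrightarrow> f \<in> P \<rightarrow>\<^sub>M N"
  using measurable_from_subalg[OF subalgebra_coord_algebra[OF sets_P]] by blast

lemma sigma_finite_level: "sigma_finite_subalgebra P (coord_algebra b (words_upto b n))"
  by (intro finite_measure_subalgebra_is_sigma_finite)
    (simp add: finite_measure_subalgebra_def finite_measure_subalgebra_axioms_def P.finite_measure_axioms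
      subalgebra_coord_algebra[OF sets_P words_upto_subset])

lemma integrable_coordinate_indicator:
  assumes "\<gamma> \<in> tree_words b" "A \<in> sets nonneg_borel"
  shows "integrable P (\<lambda>\<omega>. indicator A (\<omega> \<gamma>) :: real)"
proof (rule P.integrable_const_bound[where B=1])
  have "(\<lambda>\<omega>. \<omega> \<gamma>) \<in> P \<rightarrow>\<^sub>M nonneg_borel"
    using assms(1) by (intro measurable_P[where \<Gamma>="tree_words b"] measurable_coordinate) auto
  then show "(\<lambda>\<omega>. indicator A (\<omega> \<gamma>) :: real) \<in> borel_measurable P"
    using assms(2) by measurable
qed (auto simp: indicator_def)

lemma nn_integral_real_cond_exp:
  assumes "integrable P f" "\<And>\<omega>. \<omega> \<in> space P \<Longrightarrow> 0 \<le> f \<omega>"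
    and g: "g \<in> borel_measurable (coord_algebra b (words_upto b n))"
    and h: "AE \<omega> in P. real_cond_exp P (level_algebra b n) f \<omega> = h \<omega>"
  shows "(\<integral>\<^sup>+ \<omega>. ennreal (f \<omega>) * g \<omega> \<partial>P) = (\<integral>\<^sup>+ \<omega>. ennreal (h \<omega>) * g \<omega> \<partial>P)"
proof -
  interpret L: sigma_finite_subalgebra P "coord_algebra b (words_upto b n)" by (rule sigma_finite_level)
  have "(\<integral>\<^sup>+ \<omega>. ennreal (f \<omega>) * g \<omega> \<partial>P) = (\<integral>\<^sup>+ \<omega>. g \<omega> * ennreal (f \<omega>) \<partial>P)"
    by (simp add: mult.commute)
  also have "\<dots> = (\<integral>\<^sup>+ \<omega>. g \<omega> * nn_cond_exp P (coord_algebra b (words_upto b n)) (\<lambda>\<omega>. ennreal (f \<omega>)) \<omega> \<partial>P)"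
    using assms(1) by (intro L.nn_cond_exp_intg[symmetric] g) auto
  also have "\<dots> = (\<integral>\<^sup>+ \<omega>. ennreal (h \<omega>) * g \<omega> \<partial>P)"
  proof (rule nn_integral_cong_AE)
    have "AE \<omega> in P. ennreal (real_cond_exp P (coord_algebra b (words_upto b n)) f \<omega>) =
        nn_cond_exp P (coord_algebra b (words_upto b n)) (\<lambda>\<omega>. ennreal (f \<omega>)) \<omega>"
      using assms(1,2) by (rule L.ennreal_real_cond_exp)
    then show "AE \<omega> in P. g \<omega> * nn_cond_exp P (coord_algebra b (words_upto b n)) (\<lambda>\<omega>. ennreal (f \<omega>)) \<omega> =
        ennreal (h \<omega>) * g \<omega>"
      using h unfolding level_algebra_eq
      by eventually_elim (simp add: mult.commute)
  qed
  finally show ?thesis .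
qed

lemma density_martingale: "t \<in> space (haar b) \<Longrightarrow> martingale P (level_algebra b) (\<lambda>n. weighted_density F n t)"
  using weights by (simp add: weight_system_def positive_T_martingale_def)

lemma vertex_weight_integrable:
  assumes "\<gamma> \<in> tree_words b"
  shows "integrable P (vertex_weight F \<gamma>)"
proof -
  obtain s where s: "s \<in> space (haar b)" "prefix_of s (length \<gamma>) = \<gamma>"
    using ray_through_word[OF assms b_pos] .
  then have "integrable P (weighted_density F (length \<gamma>) s)"
    using density_martingale by (simp add: martingale_def)
  then show ?thesis using s(2) by (simp add: weighted_density_eq[abs_def])
qed

text \<open>The martingale property of a weight system is indexed by rays; any ray through \<open>\<gamma>\<close> gives the
  statement for the vertex.\<close>
lemma vertex_weight_step:
  assumes \<gamma>: "\<gamma> \<in> level_words b (Suc n)"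
    and g: "g \<in> borel_measurable (coord_algebra b (words_upto b n))"
  shows "(\<integral>\<^sup>+ \<omega>. ennreal (vertex_weight F \<gamma> \<omega>) * g \<omega> \<partial>P) =
    (\<integral>\<^sup>+ \<omega>. ennreal (vertex_weight F (take n \<gamma>) \<omega>) * g \<omega> \<partial>P)"
proof (rule nn_integral_real_cond_exp[OF _ _ g])
  have tw: "\<gamma> \<in> tree_words b" and len: "length \<gamma> = Suc n" using \<gamma> by (auto simp: level_words_def)
  obtain s where s: "s \<in> space (haar b)" "prefix_of s (Suc n) = \<gamma>"
    using ray_through_word[OF tw b_pos] len by metis
  have "prefix_of s n = take n \<gamma>" using s(2) by (auto simp flip: s(2))
  then show "AE \<omega> in P. real_cond_exp P (level_algebra b n) (vertex_weight F \<gamma>) \<omega> = vertex_weight F (take n \<gamma>) \<omega>"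
    using density_martingale[OF s(1)] s(2) unfolding martingale_def weighted_density_eq[abs_def] by metis
  show "integrable P (vertex_weight F \<gamma>)" using tw by (rule vertex_weight_integrable)
  show "\<omega> \<in> space P \<Longrightarrow> 0 \<le> vertex_weight F \<gamma> \<omega>" for \<omega>
    using tw by (simp add: space_P vertex_weight_nonneg_on_paths)
qed

text \<open>Conditional independence of two siblings, put in the form in which it is used: an event at \<open>\<delta>\<close>
  may be replaced by its conditional probability even inside an integral that involves the sibling \<open>\<gamma>\<close>.\<close>
lemma sibling_independence:
  assumes \<gamma>: "\<gamma> \<in> level_words b (Suc n)" and \<delta>: "\<delta> \<in> level_words b (Suc n)" and neq: "\<gamma> \<noteq> \<delta>"
    and A: "A \<in> sets nonneg_borel"
    and g: "g \<in> borel_measurable (coord_algebra b (insert \<gamma> (words_upto b n)))"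
  shows "(\<integral>\<^sup>+ \<omega>. indicator A (\<omega> \<delta>) * g \<omega> \<partial>P) =
    (\<integral>\<^sup>+ \<omega>. nn_cond_exp P (coord_algebra b (words_upto b n)) (\<lambda>\<omega>. indicator A (\<omega> \<delta>)) \<omega> * g \<omega> \<partial>P)"
proof (rule nn_integral_eq_on_insert_coordinate[OF sets_P _ _ _ _ _ g])
  let ?L = "coord_algebra b (words_upto b n)"
  interpret L: sigma_finite_subalgebra P ?L by (rule sigma_finite_level)
  have tw: "\<gamma> \<in> tree_words b" "\<delta> \<in> tree_words b" using \<gamma> \<delta> by (auto simp: level_words_def)
  have coord [measurable]: "(\<lambda>\<omega>. \<omega> \<gamma>) \<in> P \<rightarrow>\<^sub>M nonneg_borel" "(\<lambda>\<omega>. \<omega> \<delta>) \<in> P \<rightarrow>\<^sub>M nonneg_borel"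
    using tw by (auto intro!: measurable_P[where \<Gamma>="tree_words b"] measurable_coordinate)
  note A [measurable]
  show "insert \<gamma> (words_upto b n) \<subseteq> tree_words b" using tw words_upto_subset by auto
  show "(\<lambda>\<omega>. indicator A (\<omega> \<delta>) :: ennreal) \<in> borel_measurable P" by measurable
  show "nn_cond_exp P ?L (\<lambda>\<omega>. indicator A (\<omega> \<delta>)) \<in> borel_measurable P" by simp
  have "(\<integral>\<^sup>+ \<omega>. indicator A (\<omega> \<delta>) \<partial>P) \<le> (\<integral>\<^sup>+ \<omega>. 1 \<partial>P)"
    by (intro nn_integral_mono) (auto simp: indicator_def)
  then show "(\<integral>\<^sup>+ \<omega>. indicator A (\<omega> \<delta>) \<partial>P) < \<infinity>"
    by (simp add: P.emeasure_space_1 le_less_trans)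
  fix B D assume B: "B \<in> sets ?L" and D [measurable]: "D \<in> sets nonneg_borel"
  note B [measurable]
  have [measurable]: "B \<in> sets P"
    using B L.subalg by (auto simp: subalgebra_def)
  let ?EA = "real_cond_exp P ?L (\<lambda>\<omega>. indicator A (\<omega> \<delta>))" and ?ED = "real_cond_exp P ?L (\<lambda>\<omega>. indicator D (\<omega> \<gamma>))"
  have "cond_indep_vars P ?L (\<lambda>_. nonneg_borel) (\<lambda>\<gamma> \<omega>. \<omega> \<gamma>) {\<gamma> \<in> tree_words b. length \<gamma> = Suc n}"
    using generator by (simp add: cascade_generator_def level_algebra_eq)
  then have "AE \<omega> in P. real_cond_exp P ?L (\<lambda>\<omega>'. \<Prod>j\<in>{\<delta>, \<gamma>}. indicator (if j = \<delta> then A else D) (\<omega>' j)) \<omega> =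
      (\<Prod>j\<in>{\<delta>, \<gamma>}. real_cond_exp P ?L (\<lambda>\<omega>'. indicator (if j = \<delta> then A else D) (\<omega>' j)) \<omega>)"
    using \<gamma> \<delta> A D unfolding cond_indep_vars_def level_words_def
    by (elim conjE allE[of _ "{\<delta>, \<gamma>}"] impE) (auto dest!: spec[of _ "\<lambda>j. if j = \<delta> then A else D"])
  then have indep: "AE \<omega> in P. real_cond_exp P ?L (\<lambda>\<omega>. indicator A (\<omega> \<delta>) * indicator D (\<omega> \<gamma>)) \<omega> = ?EA \<omega> * ?ED \<omega>"
    using neq by simp
  have iA: "integrable P (\<lambda>\<omega>. indicator A (\<omega> \<delta>) :: real)" and iD: "integrable P (\<lambda>\<omega>. indicator D (\<omega> \<gamma>) :: real)"
    using tw A D by (auto intro: integrable_coordinate_indicator)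
  have iAD: "integrable P (\<lambda>\<omega>. indicator A (\<omega> \<delta>) * indicator D (\<omega> \<gamma>) :: real)"
    by (rule P.integrable_const_bound[where B=1]) (auto simp: indicator_def)
  have "(\<integral>\<^sup>+ \<omega>. indicator A (\<omega> \<delta>) * (indicator B \<omega> * indicator D (\<omega> \<gamma>)) \<partial>P) =
      (\<integral>\<^sup>+ \<omega>. ennreal (indicator A (\<omega> \<delta>) * indicator D (\<omega> \<gamma>)) * indicator B \<omega> \<partial>P)"
    by (intro nn_integral_cong) (auto simp: indicator_def)
  also have "\<dots> = (\<integral>\<^sup>+ \<omega>. ennreal (?EA \<omega> * ?ED \<omega>) * indicator B \<omega> \<partial>P)"
    using B indep by (intro nn_integral_real_cond_exp iAD) (auto simp: level_algebra_eq)
  also have "\<dots> = (\<integral>\<^sup>+ \<omega>. (indicator B \<omega> * nn_cond_exp P ?L (\<lambda>\<omega>. indicator A (\<omega> \<delta>)) \<omega>) *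
      nn_cond_exp P ?L (\<lambda>\<omega>. indicator D (\<omega> \<gamma>)) \<omega> \<partial>P)"
  proof (rule nn_integral_cong_AE)
    have "AE \<omega> in P. 0 \<le> ?EA \<omega>"
      by (rule L.real_cond_exp_pos) auto
    moreover have "AE \<omega> in P. 0 \<le> ?ED \<omega>"
      by (rule L.real_cond_exp_pos) auto
    moreover have "AE \<omega> in P. ennreal (?EA \<omega>) = nn_cond_exp P ?L (\<lambda>\<omega>. ennreal (indicator A (\<omega> \<delta>))) \<omega>"
      using iA by (rule L.ennreal_real_cond_exp) simp
    moreover have "AE \<omega> in P. ennreal (?ED \<omega>) = nn_cond_exp P ?L (\<lambda>\<omega>. ennreal (indicator D (\<omega> \<gamma>))) \<omega>"
      using iD by (rule L.ennreal_real_cond_exp) simp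
    ultimately show "AE \<omega> in P. ennreal (?EA \<omega> * ?ED \<omega>) * indicator B \<omega> =
        (indicator B \<omega> * nn_cond_exp P ?L (\<lambda>\<omega>. indicator A (\<omega> \<delta>)) \<omega>) * nn_cond_exp P ?L (\<lambda>\<omega>. indicator D (\<omega> \<gamma>)) \<omega>"
      by eventually_elim (simp add: ennreal_mult mult_ac ennreal_indicator)
  qed
  also have "\<dots> = (\<integral>\<^sup>+ \<omega>. (indicator B \<omega> * nn_cond_exp P ?L (\<lambda>\<omega>. indicator A (\<omega> \<delta>)) \<omega>) *
      indicator D (\<omega> \<gamma>) \<partial>P)"
    by (rule L.nn_cond_exp_intg) auto
  finally show "(\<integral>\<^sup>+ \<omega>. indicator A (\<omega> \<delta>) * (indicator B \<omega> * indicator D (\<omega> \<gamma>)) \<partial>P) =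
      (\<integral>\<^sup>+ \<omega>. nn_cond_exp P ?L (\<lambda>\<omega>. indicator A (\<omega> \<delta>)) \<omega> * (indicator B \<omega> * indicator D (\<omega> \<gamma>)) \<partial>P)"
    by (simp add: mult_ac)
qed

text \<open>Knowing the sibling \<open>\<delta>\<close> does not change the conditional mean of the weight at \<open>\<gamma>\<close>: first the
  event at \<open>\<delta>\<close> becomes a function of the levels up to \<open>n\<close>, then \<open>vertex_weight_step\<close> applies, then the
  replacement is undone.\<close>
lemma vertex_weight_step_sibling:
  assumes \<gamma>: "\<gamma> \<in> level_words b (Suc n)" and \<delta>: "\<delta> \<in> level_words b (Suc n)" and neq: "\<gamma> \<noteq> \<delta>"
    and g: "g \<in> borel_measurable (coord_algebra b (insert \<delta> (words_upto b n)))"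
  shows "(\<integral>\<^sup>+ \<omega>. ennreal (vertex_weight F \<gamma> \<omega>) * g \<omega> \<partial>P) =
    (\<integral>\<^sup>+ \<omega>. ennreal (vertex_weight F (take n \<gamma>) \<omega>) * g \<omega> \<partial>P)"
proof (rule nn_integral_eq_on_insert_coordinate[OF sets_P _ _ _ _ _ g])
  let ?L = "coord_algebra b (words_upto b n)"
  interpret L: sigma_finite_subalgebra P ?L by (rule sigma_finite_level)
  have tw: "\<gamma> \<in> tree_words b" "\<delta> \<in> tree_words b" "take n \<gamma> \<in> tree_words b" and len: "length \<gamma> = Suc n"
    using \<gamma> \<delta> by (auto simp: level_words_def take_in_tree_words)
  have [measurable]: "(\<lambda>\<omega>. \<omega> \<delta>) \<in> P \<rightarrow>\<^sub>M nonneg_borel"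
    using tw by (auto intro!: measurable_P[where \<Gamma>="tree_words b"] measurable_coordinate)
  show "insert \<delta> (words_upto b n) \<subseteq> tree_words b" using tw words_upto_subset by auto
  show [measurable]: "(\<lambda>\<omega>. ennreal (vertex_weight F \<gamma> \<omega>)) \<in> borel_measurable P"
    "(\<lambda>\<omega>. ennreal (vertex_weight F (take n \<gamma>) \<omega>)) \<in> borel_measurable P"
    using vertex_weight_integrable[OF tw(1)] vertex_weight_integrable[OF tw(3)] by auto
  have "(\<integral>\<^sup>+ \<omega>. ennreal (vertex_weight F \<gamma> \<omega>) \<partial>P) = ennreal (\<integral>\<omega>. vertex_weight F \<gamma> \<omega> \<partial>P)"
    using vertex_weight_integrable[OF tw(1)] tw
    by (intro nn_integral_eq_integral AE_I2) (auto simp: space_P vertex_weight_nonneg_on_paths)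
  then show "(\<integral>\<^sup>+ \<omega>. ennreal (vertex_weight F \<gamma> \<omega>) \<partial>P) < \<infinity>" by simp
  fix B A assume B: "B \<in> sets ?L" and A [measurable]: "A \<in> sets nonneg_borel"
  note B [measurable]
  have [measurable]: "B \<in> sets P"
    using B L.subalg by (auto simp: subalgebra_def)
  let ?p = "nn_cond_exp P ?L (\<lambda>\<omega>. indicator A (\<omega> \<delta>))"
  have p [measurable]: "?p \<in> borel_measurable ?L" by simp
  have "vertex_weight F \<gamma> \<in> borel_measurable (coord_algebra b (insert \<gamma> (words_upto b n)))"
    using tw len words_upto_subset
    by (intro measurable_vertex_weight) (auto simp: words_upto_def take_in_tree_words min_def not_le)
  moreover have "B \<in> sets (coord_algebra b (insert \<gamma> (words_upto b n)))"
    using B sets_coord_algebra_mono by blast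
  ultimately have [measurable]: "(\<lambda>\<omega>. ennreal (vertex_weight F \<gamma> \<omega>) * indicator B \<omega>)
      \<in> borel_measurable (coord_algebra b (insert \<gamma> (words_upto b n)))" by measurable
  have "(\<integral>\<^sup>+ \<omega>. ennreal (vertex_weight F \<gamma> \<omega>) * (indicator B \<omega> * indicator A (\<omega> \<delta>)) \<partial>P) =
      (\<integral>\<^sup>+ \<omega>. indicator A (\<omega> \<delta>) * (ennreal (vertex_weight F \<gamma> \<omega>) * indicator B \<omega>) \<partial>P)"
    by (simp add: mult_ac)
  also have "\<dots> = (\<integral>\<^sup>+ \<omega>. ?p \<omega> * (ennreal (vertex_weight F \<gamma> \<omega>) * indicator B \<omega>) \<partial>P)"
    by (rule sibling_independence[OF \<gamma> \<delta> neq A]) measurable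
  also have "\<dots> = (\<integral>\<^sup>+ \<omega>. ennreal (vertex_weight F \<gamma> \<omega>) * (?p \<omega> * indicator B \<omega>) \<partial>P)"
    by (simp add: mult_ac)
  also have "\<dots> = (\<integral>\<^sup>+ \<omega>. ennreal (vertex_weight F (take n \<gamma>) \<omega>) * (?p \<omega> * indicator B \<omega>) \<partial>P)"
    by (rule vertex_weight_step[OF \<gamma>]) measurable
  also have "\<dots> = (\<integral>\<^sup>+ \<omega>. (ennreal (vertex_weight F (take n \<gamma>) \<omega>) * indicator B \<omega>) * ?p \<omega> \<partial>P)"
    by (simp add: mult_ac)
  also have "\<dots> = (\<integral>\<^sup>+ \<omega>. (ennreal (vertex_weight F (take n \<gamma>) \<omega>) * indicator B \<omega>) * indicator A (\<omega> \<delta>) \<partial>P)"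
  proof (rule L.nn_cond_exp_intg)
    have [measurable]: "vertex_weight F (take n \<gamma>) \<in> borel_measurable ?L"
      using tw by (intro measurable_vertex_weight_level) auto
    show "(\<lambda>\<omega>. ennreal (vertex_weight F (take n \<gamma>) \<omega>) * indicator B \<omega>) \<in> borel_measurable ?L" by measurable
  qed measurable
  finally show "(\<integral>\<^sup>+ \<omega>. ennreal (vertex_weight F \<gamma> \<omega>) * (indicator B \<omega> * indicator A (\<omega> \<delta>)) \<partial>P) =
      (\<integral>\<^sup>+ \<omega>. ennreal (vertex_weight F (take n \<gamma>) \<omega>) * (indicator B \<omega> * indicator A (\<omega> \<delta>)) \<partial>P)"
    by (simp add: mult_ac)
qed

lemma spine_transition_measurable:
  assumes t: "t \<in> space (haar b)" and A: "A \<in> sets nonneg_borel" and \<Gamma>: "prefix_of t ` {..N} \<subseteq> \<Gamma>" "\<Gamma> \<subseteq> tree_words b"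
  shows "(\<lambda>\<omega>. measure (q (Suc N) (\<lambda>i\<in>{..<Suc N}. \<omega> (prefix_of t i))) A) \<in> borel_measurable (coord_algebra b \<Gamma>)"
proof -
  have "(\<lambda>\<omega>. \<lambda>i\<in>{..<Suc N}. \<omega> (prefix_of t i)) \<in> coord_algebra b \<Gamma> \<rightarrow>\<^sub>M PiM {..<Suc N} (\<lambda>_. nonneg_borel)"
    using \<Gamma> by (intro measurable_restrict measurable_coordinate) auto
  moreover have "q (Suc N) \<in> PiM {..<Suc N} (\<lambda>_. nonneg_borel) \<rightarrow>\<^sub>M prob_algebra nonneg_borel"
    using generator by (simp add: cascade_generator_def mean_one_kernels_def)
  ultimately show ?thesis
    using A by measurable
qed

lemma spine_transition:
  assumes t: "t \<in> space (haar b)" and A: "A \<in> sets nonneg_borel"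
    and g: "g \<in> borel_measurable (coord_algebra b (words_upto b N))"
  shows "(\<integral>\<^sup>+ \<omega>. indicator A (\<omega> (prefix_of t (Suc N))) * g \<omega> \<partial>P) =
    (\<integral>\<^sup>+ \<omega>. ennreal (measure (q (Suc N) (\<lambda>i\<in>{..<Suc N}. \<omega> (prefix_of t i))) A) * g \<omega> \<partial>P)"
proof -
  have "(\<integral>\<^sup>+ \<omega>. ennreal (indicator A (\<omega> (prefix_of t (Suc N)))) * g \<omega> \<partial>P) =
    (\<integral>\<^sup>+ \<omega>. ennreal (measure (q (Suc N) (\<lambda>i\<in>{..<Suc N}. \<omega> (prefix_of t i))) A) * g \<omega> \<partial>P)"
  proof (rule nn_integral_real_cond_exp[OF _ _ g])
    show "AE \<omega> in P. real_cond_exp P (level_algebra b N) (\<lambda>\<omega>. indicator A (\<omega> (prefix_of t (Suc N)))) \<omega> =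
        measure (q (Suc N) (\<lambda>i\<in>{..<Suc N}. \<omega> (prefix_of t i))) A"
      using generator t A unfolding cascade_generator_def by blast
  qed (use t A in \<open>auto intro!: integrable_coordinate_indicator prefix_of_in_tree_words\<close>)
  then show ?thesis by (simp add: ennreal_indicator)
qed

text \<open>Induction on how far the spine reaches below level \<open>n+1\<close>. The conditional probability of an event
  at the deepest spine vertex is a function of the spine above it, so integrating this vertex out
  leaves a test function of the shorter trunk.\<close>
lemma vertex_weight_step_trunk:
  assumes \<gamma>: "\<gamma> \<in> level_words b (Suc n)" and t: "t \<in> space (haar b)" and neq: "\<gamma> \<noteq> prefix_of t (Suc n)"
    and g: "g \<in> borel_measurable (coord_algebra b (trunk b t n (Suc n + k)))"
  shows "(\<integral>\<^sup>+ \<omega>. ennreal (vertex_weight F \<gamma> \<omega>) * g \<omega> \<partial>P) =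
    (\<integral>\<^sup>+ \<omega>. ennreal (vertex_weight F (take n \<gamma>) \<omega>) * g \<omega> \<partial>P)"
  using g
proof (induction k arbitrary: g)
  case 0
  then show ?case
    using vertex_weight_step_sibling[OF \<gamma> prefix_of_in_level_words[OF t] neq]
    by (simp add: trunk_Suc trunk_base[OF t])
next
  case (Suc k)
  let ?N = "Suc n + k"
  let ?H = "coord_algebra b (trunk b t n ?N)"
  have tw: "\<gamma> \<in> tree_words b" "take n \<gamma> \<in> tree_words b" and len: "length \<gamma> = Suc n"
    using \<gamma> by (auto simp: level_words_def take_in_tree_words)
  have g: "g \<in> borel_measurable (coord_algebra b (insert (prefix_of t (Suc ?N)) (trunk b t n ?N)))"
    using Suc.prems by (simp add: trunk_Suc)
  show ?case
  proof (rule nn_integral_eq_on_insert_coordinate[OF sets_P _ _ _ _ _ g])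
    show "insert (prefix_of t (Suc ?N)) (trunk b t n ?N) \<subseteq> tree_words b"
      using t trunk_subset by (auto simp: prefix_of_in_tree_words)
    show "(\<lambda>\<omega>. ennreal (vertex_weight F \<gamma> \<omega>)) \<in> borel_measurable P"
      "(\<lambda>\<omega>. ennreal (vertex_weight F (take n \<gamma>) \<omega>)) \<in> borel_measurable P"
      using vertex_weight_integrable[OF tw(1)] vertex_weight_integrable[OF tw(2)] by auto
    have "(\<integral>\<^sup>+ \<omega>. ennreal (vertex_weight F \<gamma> \<omega>) \<partial>P) = ennreal (\<integral>\<omega>. vertex_weight F \<gamma> \<omega> \<partial>P)"
      using vertex_weight_integrable[OF tw(1)] tw
      by (intro nn_integral_eq_integral AE_I2) (auto simp: space_P vertex_weight_nonneg_on_paths)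
    then show "(\<integral>\<^sup>+ \<omega>. ennreal (vertex_weight F \<gamma> \<omega>) \<partial>P) < \<infinity>" by simp
    fix B A assume B [measurable]: "B \<in> sets ?H" and A: "A \<in> sets nonneg_borel"
    let ?r = "\<lambda>\<omega>. ennreal (measure (q (Suc ?N) (\<lambda>i\<in>{..<Suc ?N}. \<omega> (prefix_of t i))) A)"
    have r [measurable]: "?r \<in> borel_measurable ?H"
      using spine_transition_measurable[OF t A _ trunk_subset[OF t], of ?N n ?N] by (auto simp: trunk_def)
    have B': "B \<in> sets (coord_algebra b (words_upto b ?N))"
      using B sets_coord_algebra_mono[OF trunk_le_level[OF t, of n ?N]] by auto
    \<comment> \<open>The transition at the deepest spine vertex applies to \<open>\<gamma>\<close> and to its parent alike, as both lie above it.\<close>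
    have move: "(\<integral>\<^sup>+ \<omega>. ennreal (vertex_weight F \<delta> \<omega>) * (indicator B \<omega> * indicator A (\<omega> (prefix_of t (Suc ?N)))) \<partial>P) =
        (\<integral>\<^sup>+ \<omega>. ennreal (vertex_weight F \<delta> \<omega>) * (indicator B \<omega> * ?r \<omega>) \<partial>P)"
      if "\<delta> \<in> tree_words b" "length \<delta> \<le> ?N" for \<delta>
    proof -
      have [measurable]: "vertex_weight F \<delta> \<in> borel_measurable (coord_algebra b (words_upto b ?N))"
        using that by (rule measurable_vertex_weight_level)
      have "(\<lambda>\<omega>. ennreal (vertex_weight F \<delta> \<omega>) * indicator B \<omega>) \<in> borel_measurable (coord_algebra b (words_upto b ?N))"
        using B' by measurable
      from spine_transition[OF t A this] show ?thesis by (simp add: mult_ac)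
    qed
    have "(\<integral>\<^sup>+ \<omega>. ennreal (vertex_weight F \<gamma> \<omega>) * (indicator B \<omega> * ?r \<omega>) \<partial>P) =
        (\<integral>\<^sup>+ \<omega>. ennreal (vertex_weight F (take n \<gamma>) \<omega>) * (indicator B \<omega> * ?r \<omega>) \<partial>P)"
      by (rule Suc.IH) measurable
    then show "(\<integral>\<^sup>+ \<omega>. ennreal (vertex_weight F \<gamma> \<omega>) * (indicator B \<omega> * indicator A (\<omega> (prefix_of t (Suc ?N)))) \<partial>P) =
        (\<integral>\<^sup>+ \<omega>. ennreal (vertex_weight F (take n \<gamma>) \<omega>) * (indicator B \<omega> * indicator A (\<omega> (prefix_of t (Suc ?N)))) \<partial>P)"
      using tw len by (subst (1 2) move) auto
  qed
qed

end

section \<open>The spine law\<close>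

locale spine_cascade = weighted_cascade +
  fixes t Pt
  assumes t: "t \<in> space (haar b)" and mass: "0 < root_mass P F" and law: "spine_law b P F t Pt"
begin

sublocale Pt: prob_space Pt
  using law by (simp add: spine_law_def)

lemma sets_Pt: "sets Pt = sets (path_space b)"
  using law by (simp add: spine_law_def)

lemma space_Pt: "space Pt = space (path_space b)"
  using sets_Pt by (rule sets_eq_imp_space_eq)

lemma measurable_Pt:
  "f \<in> coord_algebra b \<Gamma> \<rightarrow>\<^sub>M N \<Longrightarrow> \<Gamma> \<subseteq> tree_words b \<Longrightarrow> f \<in> Pt \<rightarrow>\<^sub>M N"
  using measurable_from_subalg[OF subalgebra_coord_algebra[OF sets_Pt]] by blast

lemma nn_integral_spine_law:
  assumes g: "g \<in> borel_measurable (coord_algebra b (words_upto b n))"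
  shows "(\<integral>\<^sup>+ \<omega>. g \<omega> \<partial>Pt) =
    (\<integral>\<^sup>+ \<omega>. ennreal (vertex_weight F (prefix_of t n) \<omega> / root_mass P F) * g \<omega> \<partial>P)"
proof -
  let ?L = "coord_algebra b (words_upto b n)"
  have sub: "subalgebra Pt ?L" "subalgebra P ?L"
    using subalgebra_coord_algebra[OF _ words_upto_subset] sets_Pt sets_P by auto
  have [measurable]: "vertex_weight F (prefix_of t n) \<in> borel_measurable ?L"
    using t by (intro measurable_vertex_weight_level prefix_of_in_tree_words) auto
  note g [measurable]
  have d: "(\<lambda>\<omega>. ennreal (vertex_weight F (prefix_of t n) \<omega> / root_mass P F)) \<in> borel_measurable ?L"
    by measurable
  have "(\<integral>\<^sup>+ \<omega>. g \<omega> \<partial>Pt) = (\<integral>\<^sup>+ \<omega>. g \<omega> \<partial>restr_to_subalg Pt ?L)"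
    by (rule nn_integral_subalgebra2[OF sub(1) g, symmetric])
  also have "restr_to_subalg Pt ?L = density (restr_to_subalg P ?L)
      (\<lambda>\<omega>. ennreal (vertex_weight F (prefix_of t n) \<omega> / root_mass P F))"
    using law by (simp add: spine_law_def level_algebra_eq weighted_density_eq)
  also have "(\<integral>\<^sup>+ \<omega>. g \<omega> \<partial>\<dots>) = (\<integral>\<^sup>+ \<omega>. ennreal (vertex_weight F (prefix_of t n) \<omega> / root_mass P F) * g \<omega> \<partial>restr_to_subalg P ?L)"
    using measurable_in_subalg[OF sub(2) d] measurable_in_subalg[OF sub(2) g] by (rule nn_integral_density)
  also have "\<dots> = (\<integral>\<^sup>+ \<omega>. ennreal (vertex_weight F (prefix_of t n) \<omega> / root_mass P F) * g \<omega> \<partial>P)"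
    by (rule nn_integral_subalgebra2[OF sub(2)]) measurable
  finally show ?thesis .
qed

lemma measurable_path_weight:
  assumes "prefix_of t ` {..n} \<subseteq> \<Gamma>" "\<Gamma> \<subseteq> tree_words b"
  shows "path_weight t n \<in> borel_measurable (coord_algebra b \<Gamma>)"
proof -
  have [measurable]: "(\<lambda>\<omega>. \<omega> (prefix_of t i)) \<in> borel_measurable (coord_algebra b \<Gamma>)" if "i \<le> n" for i
    using assms that by (intro borel_measurable_coordinate) auto
  show ?thesis unfolding path_weight_def[abs_def]
    by (rule borel_measurable_prod) auto
qed

text \<open>The density of the spine law on level \<open>n\<close> contains the product of the spine variables as a factor,
  hence vanishes where this product does.\<close>
lemma path_weight_pos: "AE \<omega> in Pt. 0 < path_weight t n \<omega>"
proof -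
  let ?L = "coord_algebra b (words_upto b n)" and ?Z = "{\<omega> \<in> space (path_space b). path_weight t n \<omega> = 0}"
  have [measurable]: "path_weight t n \<in> borel_measurable ?L"
    using t by (intro measurable_path_weight) (auto simp: words_upto_def prefix_of_in_tree_words)
  have "{\<omega> \<in> space ?L. path_weight t n \<omega> = 0} \<in> sets ?L" by measurable
  then have Z: "?Z \<in> sets ?L" by simp
  then have [measurable]: "?Z \<in> sets Pt"
    using subalgebra_coord_algebra[OF sets_Pt words_upto_subset] by (auto simp: subalgebra_def)
  have "emeasure Pt ?Z = (\<integral>\<^sup>+ \<omega>. indicator ?Z \<omega> \<partial>Pt)" by simp
  also have "\<dots> = (\<integral>\<^sup>+ \<omega>. ennreal (vertex_weight F (prefix_of t n) \<omega> / root_mass P F) * indicator ?Z \<omega> \<partial>P)"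
    by (rule nn_integral_spine_law[OF borel_measurable_indicator[OF Z]])
  also have "\<dots> = (\<integral>\<^sup>+ \<omega>. 0 \<partial>P)"
    by (intro nn_integral_cong)
      (auto simp: indicator_def weighted_density_eq[symmetric] weighted_density_def)
  finally have "?Z \<in> null_sets Pt" by (auto simp: null_sets_def)
  then have "AE \<omega> in Pt. \<omega> \<notin> ?Z" by (rule AE_not_in)
  moreover have "AE \<omega> in Pt. \<omega> \<in> space (path_space b)" by (rule AE_I2) (simp add: space_Pt)
  ultimately show ?thesis
  proof eventually_elim
    case (elim \<omega>)
    then show ?case using path_weight_nonneg[OF elim(2) t, of n] by auto
  qed
qed

text \<open>The union starts at \<open>Suc n\<close> because \<open>vertex_weight_step_trunk\<close> speaks of trunks that reach at least one
  level below \<open>n\<close>.\<close>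
lemma spine_algebra_union:
  "spine_algebra b t n = coord_algebra b (\<Union>k. trunk b t n (Suc n + k))"
proof -
  have "range (prefix_of t) \<union> words_upto b n = (\<Union>k. trunk b t n (Suc n + k))"
  proof (intro equalityI subsetI)
    fix \<gamma> assume "\<gamma> \<in> range (prefix_of t) \<union> words_upto b n"
    then consider i where "\<gamma> = prefix_of t i" | "\<gamma> \<in> words_upto b n" by auto
    then show "\<gamma> \<in> (\<Union>k. trunk b t n (Suc n + k))"
    proof cases
      case (1 i)
      then have "\<gamma> \<in> trunk b t n (Suc n + i)" by (auto simp: trunk_def)
      then show ?thesis by blast
    qed (auto simp: trunk_def)
  qed (auto simp: trunk_def)
  then show ?thesis by (simp add: spine_algebra_eq)
qed

text \<open>For a set determined by the trunk of depth \<open>N\<close>, the spine law has the density \<open>Q\<^bsub>t|N\<^esub> / Z\<close> with respect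
  to \<open>P\<close>, and this density is a function of the same trunk; so the identity under \<open>P\<close> gives the one
  under the spine law. The product of \<open>Q\<^bsub>\<gamma>|n\<^esub>\<close> with the density need not be integrable, and the sets where
  \<open>Q\<^bsub>\<gamma>|n\<^esub> \<le> i\<close> serve as the exhausting sequence for the passage to the whole spine.\<close>
lemma vertex_weight_step_spine:
  assumes \<gamma>: "\<gamma> \<in> level_words b (Suc n)" and neq: "\<gamma> \<noteq> prefix_of t (Suc n)"
    and g: "g \<in> borel_measurable (spine_algebra b t n)"
  shows "(\<integral>\<^sup>+ \<omega>. ennreal (vertex_weight F \<gamma> \<omega>) * g \<omega> \<partial>Pt) =
    (\<integral>\<^sup>+ \<omega>. ennreal (vertex_weight F (take n \<gamma>) \<omega>) * g \<omega> \<partial>Pt)"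
proof (rule nn_integral_eq_on_generated[OF _ _ _ _ _ _ _ _ _ _ g])
  have tw: "\<gamma> \<in> tree_words b" "take n \<gamma> \<in> tree_words b" and len: "length \<gamma> = Suc n"
    using \<gamma> by (auto simp: level_words_def take_in_tree_words)
  let ?H = "\<lambda>k. coord_algebra b (trunk b t n (Suc n + k))"
  let ?C = "\<lambda>i::nat. {\<omega> \<in> space (path_space b). vertex_weight F (take n \<gamma>) \<omega> \<le> real i}"
  show sub: "subalgebra Pt (spine_algebra b t n)"
    unfolding spine_algebra_eq using sets_Pt spine_vertices_subset[OF t] by (rule subalgebra_coord_algebra)
  show "sets (spine_algebra b t n) = sigma_sets (space Pt) (\<Union>k. sets (?H k))"
    unfolding spine_algebra_union space_Pt by (rule sets_coord_algebra_UN)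
  show "Int_stable (\<Union>k. sets (?H k))"
    by (rule Int_stable_directed_coord_algebras) (auto simp: mono_def trunk_def)
  show "(\<Union>k. sets (?H k)) \<subseteq> Pow (space Pt)"
    unfolding space_Pt using sets.space_closed[of "?H _"] by auto
  show m: "(\<lambda>\<omega>. ennreal (vertex_weight F \<gamma> \<omega>)) \<in> borel_measurable Pt"
      "(\<lambda>\<omega>. ennreal (vertex_weight F (take n \<gamma>) \<omega>)) \<in> borel_measurable Pt"
    using tw by (auto intro!: measurable_Pt[where \<Gamma>="tree_words b"] measurable_compose[OF _ measurable_ennreal]
        measurable_vertex_weight take_in_tree_words)
  show eq: "(\<integral>\<^sup>+ \<omega>. ennreal (vertex_weight F \<gamma> \<omega>) * indicator X \<omega> \<partial>Pt) =
      (\<integral>\<^sup>+ \<omega>. ennreal (vertex_weight F (take n \<gamma>) \<omega>) * indicator X \<omega> \<partial>Pt)"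
    if X: "X \<in> (\<Union>k. sets (?H k))" for X
  proof -
    obtain k where X [measurable]: "X \<in> sets (?H k)" using X by auto
    let ?N = "Suc n + k" let ?L = "coord_algebra b (words_upto b ?N)"
    let ?d = "\<lambda>\<omega>. ennreal (vertex_weight F (prefix_of t ?N) \<omega> / root_mass P F)"
    have XL [measurable]: "X \<in> sets ?L"
      using X sets_coord_algebra_mono[OF trunk_le_level[OF t, of n ?N], of b] by auto
    have "vertex_weight F (prefix_of t ?N) \<in> borel_measurable (?H k)"
      using t by (intro measurable_vertex_weight prefix_of_in_tree_words trunk_subset) (auto simp: trunk_def)
    then have test: "(\<lambda>\<omega>. ?d \<omega> * indicator X \<omega>) \<in> borel_measurable (?H k)" by measurable
    have tilt: "(\<integral>\<^sup>+ \<omega>. ennreal (vertex_weight F \<delta> \<omega>) * indicator X \<omega> \<partial>Pt) =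
        (\<integral>\<^sup>+ \<omega>. ennreal (vertex_weight F \<delta> \<omega>) * (?d \<omega> * indicator X \<omega>) \<partial>P)"
      if "\<delta> \<in> tree_words b" "length \<delta> \<le> ?N" for \<delta>
    proof -
      have [measurable]: "vertex_weight F \<delta> \<in> borel_measurable ?L"
        using that by (rule measurable_vertex_weight_level)
      have "(\<integral>\<^sup>+ \<omega>. ennreal (vertex_weight F \<delta> \<omega>) * indicator X \<omega> \<partial>Pt) =
          (\<integral>\<^sup>+ \<omega>. ?d \<omega> * (ennreal (vertex_weight F \<delta> \<omega>) * indicator X \<omega>) \<partial>P)"
        by (rule nn_integral_spine_law) measurable
      then show ?thesis by (simp add: mult_ac)
    qed
    show ?thesis
      using tw len vertex_weight_step_trunk[OF \<gamma> t neq test] by (subst (1 2) tilt) auto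
  qed
  have C: "?C i \<in> sets (?H 0)" for i
  proof -
    have "vertex_weight F (take n \<gamma>) \<in> borel_measurable (?H 0)"
      using tw t by (intro measurable_vertex_weight trunk_subset)
        (auto simp: trunk_def words_upto_def take_in_tree_words)
    then have "{\<omega> \<in> space (?H 0). vertex_weight F (take n \<gamma>) \<omega> \<le> real i} \<in> sets (?H 0)" by measurable
    then show ?thesis by simp
  qed
  then show "range ?C \<subseteq> (\<Union>k. sets (?H k))" by blast
  show "(\<Union>i. ?C i) = space Pt"
    unfolding space_Pt using real_arch_simple by auto
  show "(\<integral>\<^sup>+ \<omega>. ennreal (vertex_weight F \<gamma> \<omega>) * indicator (?C i) \<omega> \<partial>Pt) < \<infinity>" for i
  proof -
    have "(\<integral>\<^sup>+ \<omega>. ennreal (vertex_weight F \<gamma> \<omega>) * indicator (?C i) \<omega> \<partial>Pt) =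
        (\<integral>\<^sup>+ \<omega>. ennreal (vertex_weight F (take n \<gamma>) \<omega>) * indicator (?C i) \<omega> \<partial>Pt)"
      using C by (intro eq) blast
    also have "\<dots> \<le> (\<integral>\<^sup>+ \<omega>. ennreal (real i) \<partial>Pt)"
      by (intro nn_integral_mono) (auto simp: indicator_def intro!: ennreal_leI)
    also have "\<dots> < \<infinity>" by (simp add: Pt.emeasure_space_1)
    finally show ?thesis .
  qed
qed

end

section \<open>The off-spine process\<close>

text \<open>Forgetting the last letter: the root has \<open>b - 1\<close> admissible children, since the letter \<open>a\<close> is
  excluded, and every vertex further down has \<open>b\<close>.\<close>
lemma sum_branches_off_drop_last:
  fixes h :: "nat list \<Rightarrow> real"
  assumes a: "a < b"
  shows "(\<Sum>\<gamma>\<in>branches_off b a (Suc 0). h (take 0 \<gamma>)) = (real b - 1) * h []"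
    and "0 < k \<Longrightarrow> (\<Sum>\<gamma>\<in>branches_off b a (Suc k). h (take k \<gamma>)) = real b * (\<Sum>\<gamma>\<in>branches_off b a k. h \<gamma>)"
proof -
  have "branches_off b a (Suc 0) = (\<lambda>x. [x]) ` ({..<b} - {a})"
    by (auto simp: branches_off_def level_words_def tree_words_def length_Suc_conv)
  then have "card (branches_off b a (Suc 0)) = b - 1"
    using a by (simp add: card_image inj_on_def)
  then show "(\<Sum>\<gamma>\<in>branches_off b a (Suc 0). h (take 0 \<gamma>)) = (real b - 1) * h []"
    using a by (simp add: of_nat_diff)
  assume k: "0 < k"
  have "(\<Sum>\<gamma>\<in>branches_off b a (Suc k). h (take k \<gamma>)) = (\<Sum>(\<gamma>, x)\<in>branches_off b a k \<times> {..<b}. h \<gamma>)"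
  proof (rule sum.reindex_bij_witness[where i="\<lambda>(\<gamma>, x). \<gamma> @ [x]" and j="\<lambda>\<gamma>. (butlast \<gamma>, last \<gamma>)"])
    fix \<gamma> assume \<gamma>: "\<gamma> \<in> branches_off b a (Suc k)"
    then have len: "length \<gamma> = Suc k" and ne: "\<gamma> \<noteq> []" by (auto simp: branches_off_def level_words_def)
    show "(case (butlast \<gamma>, last \<gamma>) of (\<gamma>, x) \<Rightarrow> \<gamma> @ [x]) = \<gamma>" using ne by simp
    have "butlast \<gamma> \<noteq> []" using len k by (cases \<gamma> rule: rev_cases) auto
    then have "hd (butlast \<gamma>) = hd \<gamma>" using ne by (cases \<gamma> rule: rev_cases) auto
    moreover have "last \<gamma> < b" "butlast \<gamma> \<in> tree_words b"
      using \<gamma> ne by (auto simp: branches_off_def level_words_def tree_words_def dest: in_set_butlastD)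
    ultimately show "(butlast \<gamma>, last \<gamma>) \<in> branches_off b a k \<times> {..<b}"
      using \<gamma> by (auto simp: branches_off_def level_words_def)
    show "(case (butlast \<gamma>, last \<gamma>) of (\<gamma>, x) \<Rightarrow> h \<gamma>) = h (take k \<gamma>)"
      using len by (simp add: butlast_conv_take)
  next
    fix y assume "y \<in> branches_off b a k \<times> {..<b}"
    then obtain \<gamma> x where y: "y = (\<gamma>, x)" "\<gamma> \<in> branches_off b a k" "x < b" by auto
    then have "\<gamma> \<noteq> []" using k by (auto simp: branches_off_def level_words_def)
    then show "(case y of (\<gamma>, x) \<Rightarrow> \<gamma> @ [x]) \<in> branches_off b a (Suc k)"
      using y by (auto simp: branches_off_def level_words_def tree_words_def)
  qed auto
  also have "\<dots> = real b * (\<Sum>\<gamma>\<in>branches_off b a k. h \<gamma>)"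
    by (simp add: sum.cartesian_product[symmetric] sum_distrib_left)
  finally show "(\<Sum>\<gamma>\<in>branches_off b a (Suc k). h (take k \<gamma>)) = real b * (\<Sum>\<gamma>\<in>branches_off b a k. h \<gamma>)" .
qed

locale off_spine = spine_cascade +
  fixes c :: "nat \<Rightarrow> (nat list \<Rightarrow> real) \<Rightarrow> (nat \<Rightarrow> nat) \<Rightarrow> real"
  assumes c_nonneg: "\<omega> \<in> space (path_space b) \<Longrightarrow> 0 \<le> c k \<omega> t"
    and c_measurable: "(\<lambda>\<omega>. c k \<omega> t) \<in> borel_measurable (spine_algebra b t 0)"
begin

abbreviation "X \<equiv> off_spine_sum b F c t"
abbreviation "G \<equiv> spine_algebra b t"

lemma space_G [simp]: "space (G n) = space (path_space b)"
  by (simp add: spine_algebra_eq)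

lemma subalgebra_G: "subalgebra Pt (G n)"
  unfolding spine_algebra_eq using sets_Pt spine_vertices_subset[OF t] by (rule subalgebra_coord_algebra)

lemma sigma_finite_G: "sigma_finite_subalgebra Pt (G n)"
  by (intro finite_measure_subalgebra_is_sigma_finite)
    (simp add: finite_measure_subalgebra_def finite_measure_subalgebra_axioms_def Pt.finite_measure_axioms subalgebra_G)

lemma sets_G_mono: "m \<le> n \<Longrightarrow> sets (G m) \<subseteq> sets (G n)"
  unfolding spine_algebra_eq using words_upto_mono by (intro sets_coord_algebra_mono) blast

lemma c_measurable_G [measurable]: "(\<lambda>\<omega>. c k \<omega> t) \<in> borel_measurable (G n)"
  using c_measurable[of k] sets_G_mono[of 0 n] by (auto simp: measurable_def)

lemma F_spine_measurable [measurable]: "F (prefix_of t j) \<in> borel_measurable (G n)"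
  unfolding spine_algebra_eq using t by (intro measurable_F prefix_of_in_tree_words) auto

lemma path_weight_measurable [measurable]: "path_weight t j \<in> borel_measurable (G n)"
  unfolding spine_algebra_eq using spine_vertices_subset[OF t] by (intro measurable_path_weight) auto

lemma branch_measurable:
  assumes "j \<le> n" "\<gamma> \<in> tree_words b" "length \<gamma> \<le> n - j"
  shows "branch_weight F (prefix_of t j) \<gamma> \<in> borel_measurable (G n)"
proof -
  let ?\<Gamma> = "range (prefix_of t) \<union> words_upto b n"
  have tj: "prefix_of t j \<in> tree_words b" using t by (rule prefix_of_in_tree_words)
  have [measurable]: "(\<lambda>\<omega>. \<omega> (prefix_of t j @ take i \<gamma>)) \<in> borel_measurable (coord_algebra b ?\<Gamma>)" for i
    using assms tj by (intro borel_measurable_coordinate spine_vertices_subset[OF t])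
      (auto simp: words_upto_def take_in_tree_words)
  have [measurable]: "F (prefix_of t j @ \<gamma>) \<in> borel_measurable (coord_algebra b ?\<Gamma>)"
    using assms tj by (intro measurable_F) (auto simp: words_upto_def take_in_tree_words prefix_of_in_tree_words[OF t])
  show ?thesis unfolding branch_weight_def[abs_def] spine_algebra_eq by measurable
qed

lemma branches_offD:
  "\<gamma> \<in> branches_off b a k \<Longrightarrow> \<gamma> \<in> tree_words b \<and> length \<gamma> = k \<and> hd \<gamma> \<noteq> a"
  by (simp add: branches_off_def level_words_def)

lemma X_measurable: "X n \<in> borel_measurable (G n)"
proof -
  have "(\<lambda>\<omega>. \<Sum>j<n. \<Sum>\<gamma>\<in>branches_off b (t j) (n - j).
     c j \<omega> t * (1 / real b) ^ (n - j) * branch_weight F (prefix_of t j) \<gamma> \<omega>) \<in> borel_measurable (G n)"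
    by (intro borel_measurable_sum borel_measurable_times c_measurable_G borel_measurable_const branch_measurable)
      (auto dest: branches_offD)
  then show ?thesis unfolding off_spine_sum_eq[abs_def] .
qed

lemma branch_nonneg:
  "\<omega> \<in> space (path_space b) \<Longrightarrow> \<gamma> \<in> tree_words b \<Longrightarrow> 0 \<le> branch_weight F (prefix_of t j) \<gamma> \<omega>"
  using t by (intro branch_weight_nonneg[where b=b]) (auto intro: F_nonneg prefix_of_in_tree_words)

lemma X_nonneg: "\<omega> \<in> space (path_space b) \<Longrightarrow> 0 \<le> X n \<omega>"
  unfolding off_spine_sum_eq
  by (intro sum_nonneg mult_nonneg_nonneg) (auto intro: c_nonneg branch_nonneg dest: branches_offD)

lemma adapted_X: "adapted Pt G X"
  unfolding adapted_def
proof (intro conjI allI)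
  show "filtration (space Pt) G"
    by unfold_locales (auto simp: space_Pt dest: sets_G_mono)
qed (simp_all add: subalgebra_G X_measurable)

text \<open>Where the product of the spine variables above \<open>t|j\<close> is positive, the branch weight is the vertex weight
  divided by this product, and the quotient can be absorbed into the test function, because the
  spine algebra knows the whole spine.\<close>
lemma branch_weight_step:
  assumes j: "j \<le> n" and \<gamma>: "\<gamma> \<in> branches_off b (t j) (Suc n - j)" and A: "A \<in> sets (G n)"
  shows "(\<integral>\<^sup>+ \<omega>. ennreal (c j \<omega> t * (1 / real b) ^ (Suc n - j) * branch_weight F (prefix_of t j) \<gamma> \<omega>) * indicator A \<omega> \<partial>Pt) =
    (\<integral>\<^sup>+ \<omega>. ennreal (c j \<omega> t * (1 / real b) ^ (Suc n - j) * branch_weight F (prefix_of t j) (take (n - j) \<gamma>) \<omega>) * indicator A \<omega> \<partial>Pt)"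
proof -
  let ?v = "prefix_of t j"
  have tw: "\<gamma> \<in> tree_words b" "take (n - j) \<gamma> \<in> tree_words b" and len: "length \<gamma> = Suc n - j" and hd: "hd \<gamma> \<noteq> t j"
    using branches_offD[OF \<gamma>] take_in_tree_words by auto
  define h where "h \<omega> = ennreal (c j \<omega> t * (1 / real b) ^ (Suc n - j) / path_weight t j \<omega>) * indicator A \<omega>" for \<omega>
  have h: "h \<in> borel_measurable (G n)" unfolding h_def[abs_def] using A by measurable
  have rewrite: "(\<integral>\<^sup>+ \<omega>. ennreal (c j \<omega> t * (1 / real b) ^ (Suc n - j) * branch_weight F ?v \<delta> \<omega>) * indicator A \<omega> \<partial>Pt) =
      (\<integral>\<^sup>+ \<omega>. ennreal (vertex_weight F (?v @ \<delta>) \<omega>) * h \<omega> \<partial>Pt)" if \<delta>: "\<delta> \<in> tree_words b" for \<delta>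
  proof (rule nn_integral_cong_AE)
    have "AE \<omega> in Pt. \<omega> \<in> space (path_space b)" by (rule AE_I2) (simp add: space_Pt)
    then show "AE \<omega> in Pt. ennreal (c j \<omega> t * (1 / real b) ^ (Suc n - j) * branch_weight F ?v \<delta> \<omega>) * indicator A \<omega> =
        ennreal (vertex_weight F (?v @ \<delta>) \<omega>) * h \<omega>"
      using path_weight_pos[of j]
    proof eventually_elim
      case (elim \<omega>)
      have "c j \<omega> t * (1 / real b) ^ (Suc n - j) * branch_weight F ?v \<delta> \<omega> =
          vertex_weight F (?v @ \<delta>) \<omega> * (c j \<omega> t * (1 / real b) ^ (Suc n - j) / path_weight t j \<omega>)"
        using elim(2) by (simp add: vertex_weight_spine_append)
      moreover have "0 \<le> vertex_weight F (?v @ \<delta>) \<omega>"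
        using elim(1) \<delta> prefix_of_in_tree_words[OF t] by (intro vertex_weight_nonneg_on_paths) auto
      ultimately show ?case
        by (simp only: h_def ennreal_mult' mult.assoc)
    qed
  qed
  have "?v @ \<gamma> \<in> level_words b (Suc n)"
    using tw len j t by (auto simp: level_words_def prefix_of_in_tree_words)
  moreover have "?v @ \<gamma> \<noteq> prefix_of t (Suc n)"
  proof
    assume "?v @ \<gamma> = prefix_of t (Suc n)"
    then have "(?v @ \<gamma>) ! j = t j" using j by simp
    moreover have "\<gamma> \<noteq> []" using len j by auto
    ultimately show False using hd by (simp add: nth_append hd_conv_nth)
  qed
  ultimately have "(\<integral>\<^sup>+ \<omega>. ennreal (vertex_weight F (?v @ \<gamma>) \<omega>) * h \<omega> \<partial>Pt) =
      (\<integral>\<^sup>+ \<omega>. ennreal (vertex_weight F (take n (?v @ \<gamma>)) \<omega>) * h \<omega> \<partial>Pt)"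
    using h by (rule vertex_weight_step_spine)
  also have "take n (?v @ \<gamma>) = ?v @ take (n - j) \<gamma>" using j by (simp add: min_def)
  finally show ?thesis using tw by (simp only: rewrite)
qed

text \<open>After every branch weight has been replaced by that of its parent, the branches that left the ray
  before level \<open>n\<close> give back the off-spine sum of level \<open>n\<close>; those leaving at \<open>t|n\<close> give the drift.\<close>
lemma sum_parents:
  "(\<Sum>j<Suc n. \<Sum>\<gamma>\<in>branches_off b (t j) (Suc n - j).
      c j \<omega> t * (1 / real b) ^ (Suc n - j) * branch_weight F (prefix_of t j) (take (n - j) \<gamma>) \<omega>) =
    X n \<omega> + (real b - 1) / real b * weighted_coeff F c n \<omega> t"
proof -
  have tb: "t j < b" for j using t by (simp add: in_space_haar)
  have "(\<Sum>\<gamma>\<in>branches_off b (t j) (Suc n - j).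
      c j \<omega> t * (1 / real b) ^ (Suc n - j) * branch_weight F (prefix_of t j) (take (n - j) \<gamma>) \<omega>) =
    (\<Sum>\<gamma>\<in>branches_off b (t j) (n - j). c j \<omega> t * (1 / real b) ^ (n - j) * branch_weight F (prefix_of t j) \<gamma> \<omega>)"
    if "j < n" for j
    using sum_branches_off_drop_last(2)[where a="t j" and b=b and k="n - j" and
        h="\<lambda>\<gamma>. branch_weight F (prefix_of t j) \<gamma> \<omega>", OF tb] that b_pos
    unfolding sum_distrib_left[symmetric] by (simp add: Suc_diff_le)
  moreover have "(\<Sum>\<gamma>\<in>branches_off b (t n) (Suc n - n).
      c n \<omega> t * (1 / real b) ^ (Suc n - n) * branch_weight F (prefix_of t n) (take (n - n) \<gamma>) \<omega>) =
      (real b - 1) / real b * weighted_coeff F c n \<omega> t"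
    using sum_branches_off_drop_last(1)[where a="t n" and b=b and
        h="\<lambda>\<gamma>. branch_weight F (prefix_of t n) \<gamma> \<omega>", OF tb]
    by (simp add: sum_distrib_left[symmetric] weighted_coeff_def branch_weight_def Suc_diff_le)
  ultimately show ?thesis unfolding off_spine_sum_eq sum.lessThan_Suc by simp
qed

lemma weighted_coeff_nonneg: "\<omega> \<in> space (path_space b) \<Longrightarrow> 0 \<le> weighted_coeff F c n \<omega> t"
  using t by (auto simp: weighted_coeff_def c_nonneg F_nonneg prefix_of_in_tree_words)

lemma drift_Suc: "drift b d t (Suc n) \<omega> - drift b d t n \<omega> = (real b - 1) / real b * d n \<omega> t"
  by (simp add: drift_def algebra_simps)

lemma nn_cond_exp_X:
  "AE \<omega> in Pt. nn_cond_exp Pt (G n) (\<lambda>\<omega>. ennreal (X (Suc n) \<omega>)) \<omega> =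
    ennreal (X n \<omega>) + ennreal ((real b - 1) / real b * weighted_coeff F c n \<omega> t)"
proof -
  interpret G: sigma_finite_subalgebra Pt "G n" by (rule sigma_finite_G)
  let ?a = "\<lambda>j \<gamma> \<omega>. c j \<omega> t * (1 / real b) ^ (Suc n - j) * branch_weight F (prefix_of t j) \<gamma> \<omega>"
  let ?S = "\<lambda>j. branches_off b (t j) (Suc n - j)"
  have nonneg: "0 \<le> ?a j \<gamma> \<omega>" if "\<omega> \<in> space Pt" "\<gamma> \<in> tree_words b" for j \<gamma> \<omega>
    using that by (auto simp: space_Pt intro!: mult_nonneg_nonneg c_nonneg branch_nonneg)
  have meas: "(\<lambda>\<omega>. ?a j \<gamma> \<omega>) \<in> borel_measurable Pt" if "j \<le> Suc n" "\<gamma> \<in> tree_words b" "length \<gamma> \<le> Suc n - j" for j \<gamma>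
    by (intro measurable_from_subalg[OF subalgebra_G[of "Suc n"]] borel_measurable_times c_measurable_G
        borel_measurable_const branch_measurable that)
  let ?Y = "\<lambda>\<omega>. X n \<omega> + (real b - 1) / real b * weighted_coeff F c n \<omega> t"
  have Y: "?Y \<in> borel_measurable (G n)"
    unfolding weighted_coeff_def[abs_def] by (intro borel_measurable_add X_measurable) measurable
  have "AE \<omega> in Pt. ennreal (?Y \<omega>) = nn_cond_exp Pt (G n) (\<lambda>\<omega>. ennreal (X (Suc n) \<omega>)) \<omega>"
  proof (rule G.nn_cond_exp_charact)
    fix A assume A: "A \<in> sets (G n)"
    have A': "A \<in> sets Pt" using A subalgebra_G by (auto simp: subalgebra_def)
    have expand: "(\<integral>\<^sup>+ \<omega>. ennreal (\<Sum>j<Suc n. \<Sum>\<gamma>\<in>?S j. ?a j (p j \<gamma>) \<omega>) * indicator A \<omega> \<partial>Pt) =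
        (\<Sum>j<Suc n. \<Sum>\<gamma>\<in>?S j. \<integral>\<^sup>+ \<omega>. ennreal (?a j (p j \<gamma>) \<omega>) * indicator A \<omega> \<partial>Pt)"
      if p: "\<And>j \<gamma>. \<gamma> \<in> ?S j \<Longrightarrow> p j \<gamma> \<in> tree_words b \<and> length (p j \<gamma>) \<le> Suc n - j" for p
    proof -
      have "(\<integral>\<^sup>+ \<omega>. ennreal (\<Sum>j<Suc n. \<Sum>\<gamma>\<in>?S j. ?a j (p j \<gamma>) \<omega>) * indicator A \<omega> \<partial>Pt) =
          (\<integral>\<^sup>+ \<omega>. (\<Sum>j<Suc n. \<Sum>\<gamma>\<in>?S j. ennreal (?a j (p j \<gamma>) \<omega>) * indicator A \<omega>) \<partial>Pt)"
      proof (rule nn_integral_cong)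
        fix \<omega> assume \<omega>: "\<omega> \<in> space Pt"
        have "ennreal (\<Sum>j<Suc n. \<Sum>\<gamma>\<in>?S j. ?a j (p j \<gamma>) \<omega>) = (\<Sum>j<Suc n. \<Sum>\<gamma>\<in>?S j. ennreal (?a j (p j \<gamma>) \<omega>))"
          using nonneg[OF \<omega>] p by (simp add: sum_ennreal sum_nonneg del: sum.lessThan_Suc)
        then show "ennreal (\<Sum>j<Suc n. \<Sum>\<gamma>\<in>?S j. ?a j (p j \<gamma>) \<omega>) * indicator A \<omega> =
            (\<Sum>j<Suc n. \<Sum>\<gamma>\<in>?S j. ennreal (?a j (p j \<gamma>) \<omega>) * indicator A \<omega>)"
          by (simp only: sum_distrib_right)
      qed
      also have "\<dots> = (\<Sum>j<Suc n. \<integral>\<^sup>+ \<omega>. (\<Sum>\<gamma>\<in>?S j. ennreal (?a j (p j \<gamma>) \<omega>) * indicator A \<omega>) \<partial>Pt)"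
        using A' p by (intro nn_integral_sum borel_measurable_sum borel_measurable_times_ennreal
            measurable_compose[OF meas measurable_ennreal] borel_measurable_indicator) auto
      also have "\<dots> = (\<Sum>j<Suc n. \<Sum>\<gamma>\<in>?S j. \<integral>\<^sup>+ \<omega>. ennreal (?a j (p j \<gamma>) \<omega>) * indicator A \<omega> \<partial>Pt)"
        using A' p by (intro sum.cong refl nn_integral_sum borel_measurable_times_ennreal
            measurable_compose[OF meas measurable_ennreal] borel_measurable_indicator) auto
      finally show ?thesis .
    qed
    have "(\<integral>\<^sup>+ \<omega>. ennreal (X (Suc n) \<omega>) * indicator A \<omega> \<partial>Pt) =
        (\<Sum>j<Suc n. \<Sum>\<gamma>\<in>?S j. \<integral>\<^sup>+ \<omega>. ennreal (?a j \<gamma> \<omega>) * indicator A \<omega> \<partial>Pt)"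
      unfolding off_spine_sum_eq by (rule expand[of "\<lambda>j \<gamma>. \<gamma>"]) (auto dest: branches_offD)
    also have "\<dots> = (\<Sum>j<Suc n. \<Sum>\<gamma>\<in>?S j. \<integral>\<^sup>+ \<omega>. ennreal (?a j (take (n - j) \<gamma>) \<omega>) * indicator A \<omega> \<partial>Pt)"
      by (intro sum.cong refl branch_weight_step A) auto
    also have "\<dots> = (\<integral>\<^sup>+ \<omega>. ennreal (\<Sum>j<Suc n. \<Sum>\<gamma>\<in>?S j. ?a j (take (n - j) \<gamma>) \<omega>) * indicator A \<omega> \<partial>Pt)"
      by (rule expand[of "\<lambda>j. take (n - j)", symmetric]) (auto dest: branches_offD simp: take_in_tree_words)
    also have "\<dots> = (\<integral>\<^sup>+ \<omega>. ennreal (?Y \<omega>) * indicator A \<omega> \<partial>Pt)"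
      unfolding sum_parents ..
    finally show "(\<integral>\<^sup>+ \<omega>\<in>A. ennreal (X (Suc n) \<omega>) \<partial>Pt) = (\<integral>\<^sup>+ \<omega>\<in>A. ennreal (?Y \<omega>) \<partial>Pt)" .
  next
    show "(\<lambda>\<omega>. ennreal (X (Suc n) \<omega>)) \<in> borel_measurable Pt"
      using measurable_from_subalg[OF subalgebra_G X_measurable] by measurable
    show "(\<lambda>\<omega>. ennreal (?Y \<omega>)) \<in> borel_measurable (G n)" using Y by measurable
  qed
  moreover have "AE \<omega> in Pt. ennreal (?Y \<omega>) = ennreal (X n \<omega>) + ennreal ((real b - 1) / real b * weighted_coeff F c n \<omega> t)"
    using b2 by (intro AE_I2 ennreal_plus X_nonneg mult_nonneg_nonneg weighted_coeff_nonneg) (auto simp: space_Pt)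
  ultimately show ?thesis by eventually_elim simp
qed

lemma nonneg_submartingale_X: "nonneg_submartingale Pt G X"
  unfolding nonneg_submartingale_def
proof (intro conjI allI adapted_X ballI)
  show "\<omega> \<in> space Pt \<Longrightarrow> 0 \<le> X n \<omega>" for n \<omega> by (simp add: space_Pt X_nonneg)
  show "AE \<omega> in Pt. ennreal (X n \<omega>) \<le> nn_cond_exp Pt (G n) (\<lambda>\<omega>'. ennreal (X (Suc n) \<omega>')) \<omega>" for n
    using nn_cond_exp_X[of n] by eventually_elim simp
qed

text \<open>The coefficient \<open>d\<close> is either \<open>weighted_coeff F c\<close> or, on rays where the two agree almost surely, \<open>c\<close>.\<close>
lemma nonneg_doob_drift:
  assumes d_meas: "\<And>k. (\<lambda>\<omega>. d k \<omega> t) \<in> borel_measurable (G 0)"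
    and d_nonneg: "\<And>k \<omega>. \<omega> \<in> space (path_space b) \<Longrightarrow> 0 \<le> d k \<omega> t"
    and d_eq: "\<And>k. AE \<omega> in Pt. weighted_coeff F c k \<omega> t = d k \<omega> t"
  shows "nonneg_doob_predictable_part Pt G X (drift b d t)"
  unfolding nonneg_doob_predictable_part_def predictable_from_zero_def
proof (intro conjI allI ballI)
  show "drift b d t 0 \<omega> = 0" for \<omega> by (simp add: drift_def)
  have [measurable]: "(\<lambda>\<omega>. d k \<omega> t) \<in> borel_measurable (G n)" for k n
    using d_meas[of k] sets_G_mono[of 0 n] by (auto simp: measurable_def)
  show "drift b d t (Suc n) \<in> borel_measurable (G n)" for n
    unfolding drift_def[abs_def] by measurable
  show "drift b d t n \<omega> \<le> drift b d t (Suc n) \<omega>" if "\<omega> \<in> space Pt" for n \<omega>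
  proof -
    have "0 \<le> (real b - 1) / real b * d n \<omega> t"
      using that b2 d_nonneg by (simp add: space_Pt)
    then show ?thesis using drift_Suc[of d n \<omega>] by simp
  qed
  show "AE \<omega> in Pt. nn_cond_exp Pt (G n) (\<lambda>\<omega>'. ennreal (X (Suc n) \<omega>')) \<omega> =
      ennreal (X n \<omega>) + ennreal (drift b d t (Suc n) \<omega> - drift b d t n \<omega>)" for n
    using nn_cond_exp_X[of n] d_eq[of n] by eventually_elim (simp only: drift_Suc)
qed

lemma nonneg_doob_weighted_drift: "nonneg_doob_predictable_part Pt G X (drift b (weighted_coeff F c) t)"
proof (rule nonneg_doob_drift)
  show "(\<lambda>\<omega>. weighted_coeff F c k \<omega> t) \<in> borel_measurable (G 0)" for k
    unfolding weighted_coeff_def by measurable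
qed (auto simp: weighted_coeff_nonneg)

end

section \<open>Integrable drift\<close>

text \<open>Since the expected increment of \<open>X\<close> is that of \<open>A\<close>, integrability of \<open>A\<close> propagates to \<open>X\<close> along the
  levels, and then all conditional expectations are finite.\<close>
lemma doob_of_nonneg_doob:
  assumes "finite_measure M" and sub: "nonneg_submartingale M G X" and doob: "nonneg_doob_predictable_part M G X A"
    and A: "\<And>n. integrable M (A n)" and X0: "integrable M (X 0)"
  shows "submartingale M G X" "doob_predictable_part M G X A"
proof -
  interpret finite_measure M by fact
  have adX: "adapted M G X" and X_nonneg: "\<And>n \<omega>. \<omega> \<in> space M \<Longrightarrow> 0 \<le> X n \<omega>"
    using sub by (auto simp: nonneg_submartingale_def)
  have fil: "filtration (space M) G" and subalg: "\<And>n. subalgebra M (G n)" and XG: "\<And>n. X n \<in> borel_measurable (G n)"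
    using adX by (auto simp: adapted_def)
  have pred: "predictable_from_zero M G A" and A_mono: "\<And>n \<omega>. \<omega> \<in> space M \<Longrightarrow> A n \<omega> \<le> A (Suc n) \<omega>"
    and ce: "\<And>n. AE \<omega> in M. nn_cond_exp M (G n) (\<lambda>\<omega>. ennreal (X (Suc n) \<omega>)) \<omega> =
        ennreal (X n \<omega>) + ennreal (A (Suc n) \<omega> - A n \<omega>)"
    using doob by (auto simp: nonneg_doob_predictable_part_def)
  have sf: "sigma_finite_subalgebra M (G n)" for n
    using subalg by (intro finite_measure_subalgebra_is_sigma_finite)
      (simp add: finite_measure_subalgebra_def finite_measure_subalgebra_axioms_def finite_measure_axioms)
  have XM [measurable]: "X n \<in> borel_measurable M" for n
    using measurable_from_subalg[OF subalg XG] .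
  have AM [measurable]: "A n \<in> borel_measurable M" for n using A by auto
  have X: "integrable M (X n)" for n
  proof (induction n)
    case (Suc n)
    interpret G: sigma_finite_subalgebra M "G n" by (rule sf)
    have "(\<integral>\<^sup>+ \<omega>. ennreal (X (Suc n) \<omega>) \<partial>M) = (\<integral>\<^sup>+ \<omega>. nn_cond_exp M (G n) (\<lambda>\<omega>. ennreal (X (Suc n) \<omega>)) \<omega> \<partial>M)"
      using G.nn_cond_exp_intg[of "\<lambda>_. 1" "\<lambda>\<omega>. ennreal (X (Suc n) \<omega>)"] by simp
    also have "\<dots> = (\<integral>\<^sup>+ \<omega>. ennreal (X n \<omega> + (A (Suc n) \<omega> - A n \<omega>)) \<partial>M)"
    proof (rule nn_integral_cong_AE)
      have "AE \<omega> in M. \<omega> \<in> space M" by simp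
      with ce[of n] show "AE \<omega> in M. nn_cond_exp M (G n) (\<lambda>\<omega>. ennreal (X (Suc n) \<omega>)) \<omega> =
          ennreal (X n \<omega> + (A (Suc n) \<omega> - A n \<omega>))"
        by eventually_elim (simp add: X_nonneg A_mono ennreal_plus)
    qed
    also have "\<dots> = ennreal (\<integral> \<omega>. X n \<omega> + (A (Suc n) \<omega> - A n \<omega>) \<partial>M)"
      using Suc A by (intro nn_integral_eq_integral AE_I2) (auto simp: X_nonneg A_mono)
    finally show ?case
      by (intro integrableI_nonneg) (auto simp: X_nonneg)
  qed (rule X0)
  have rce: "AE \<omega> in M. real_cond_exp M (G n) (X (Suc n)) \<omega> = X n \<omega> + (A (Suc n) \<omega> - A n \<omega>)" for n
  proof -
    interpret G: sigma_finite_subalgebra M "G n" by (rule sf)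
    have "AE \<omega> in M. ennreal (real_cond_exp M (G n) (X (Suc n)) \<omega>) = nn_cond_exp M (G n) (\<lambda>\<omega>. ennreal (X (Suc n) \<omega>)) \<omega>"
      using X X_nonneg by (rule G.ennreal_real_cond_exp)
    moreover have "AE \<omega> in M. 0 \<le> real_cond_exp M (G n) (X (Suc n)) \<omega>"
      using X_nonneg by (intro G.real_cond_exp_pos AE_I2) auto
    moreover have "AE \<omega> in M. \<omega> \<in> space M" by simp
    ultimately show ?thesis using ce[of n]
      by eventually_elim (simp add: X_nonneg A_mono flip: ennreal_plus)
  qed
  show "submartingale M G X"
    unfolding submartingale_def
  proof (intro conjI allI adX X)
    fix n
    have "AE \<omega> in M. \<omega> \<in> space M" by simp
    with rce[of n] show "AE \<omega> in M. X n \<omega> \<le> real_cond_exp M (G n) (X (Suc n)) \<omega>"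
      by eventually_elim (simp add: A_mono)
  qed
  have AG: "A n \<in> borel_measurable (G n)" for n
  proof (cases n)
    case 0
    have "A 0 \<omega> = 0" if "\<omega> \<in> space (G 0)" for \<omega>
      using that pred subalg[of 0] by (simp add: predictable_from_zero_def subalgebra_def)
    then show ?thesis unfolding 0 by (subst measurable_cong[where g="\<lambda>_. 0"]) auto
  next
    case (Suc m)
    have "sets (G m) \<subseteq> sets (G n)" using filtration.sets_F_mono[OF fil, of m n] Suc by simp
    moreover have "space (G m) = space (G n)" using subalg by (simp add: subalgebra_def)
    moreover have "A n \<in> borel_measurable (G m)" using pred Suc by (simp add: predictable_from_zero_def)
    ultimately show ?thesis by (auto simp: measurable_def)
  qed
  show "doob_predictable_part M G X A"
    unfolding doob_predictable_part_def martingale_def adapted_def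
  proof (intro conjI allI pred fil subalg)
    show "(\<lambda>\<omega>. X n \<omega> - A n \<omega>) \<in> borel_measurable (G n)" for n using XG AG by measurable
    show "integrable M (\<lambda>\<omega>. X n \<omega> - A n \<omega>)" for n using X A by simp
    fix n
    interpret G: sigma_finite_subalgebra M "G n" by (rule sf)
    have "A (Suc n) \<in> borel_measurable (G n)" using pred by (simp add: predictable_from_zero_def)
    with A have "AE \<omega> in M. real_cond_exp M (G n) (A (Suc n)) \<omega> = A (Suc n) \<omega>"
      by (rule G.real_cond_exp_F_meas)
    with rce[of n] G.real_cond_exp_diff[OF X A, of "Suc n" "Suc n"]
    show "AE \<omega> in M. real_cond_exp M (G n) (\<lambda>\<omega>. X (Suc n) \<omega> - A (Suc n) \<omega>) \<omega> = X n \<omega> - A n \<omega>"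
      by eventually_elim simp
  qed
qed

context off_spine
begin

lemma submartingale_of_integrable_drift:
  assumes "nonneg_doob_predictable_part Pt G X (drift b d t)" "\<And>n. integrable Pt (drift b d t n)"
  shows "submartingale Pt G X \<and> doob_predictable_part Pt G X (drift b d t)"
proof -
  have "X 0 = (\<lambda>_. 0)" by (simp add: off_spine_sum_def fun_eq_iff)
  then have "integrable Pt (X 0)" by simp
  with Pt.finite_measure_axioms nonneg_submartingale_X assms show ?thesis
    by (blast intro: doob_of_nonneg_doob)
qed

lemma integrable_drift:
  assumes fin: "\<And>k. (\<integral>\<^sup>+ \<omega>. ennreal (c k \<omega> t) \<partial>Pt) < \<infinity>"
  shows "integrable Pt (drift b c t n)"
proof -
  have "integrable Pt (\<lambda>\<omega>. c k \<omega> t)" for k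
    using fin[of k] measurable_from_subalg[OF subalgebra_G c_measurable_G, of k]
    by (intro integrableI_nonneg AE_I2) (auto simp: space_Pt c_nonneg)
  then show ?thesis unfolding drift_def[abs_def] by simp
qed

end

section \<open>Disintegration of the joint law\<close>

lemma sets_path_space_levels:
  "sets (path_space b) = sigma_sets (space (path_space b)) (\<Union>n. sets (coord_algebra b (words_upto b n)))"
proof -
  have "sets (path_space b) = sets (coord_algebra b (tree_words b))"
    unfolding sets_coord_algebra by (simp add: path_space_def sets_PiM_single space_PiM)
  also have "tree_words b = (\<Union>n. words_upto b n)"
    by (auto simp: words_upto_def)
  finally show ?thesis by (simp add: sets_coord_algebra_UN)
qed

lemma Int_stable_levels: "Int_stable (\<Union>n. sets (coord_algebra b (words_upto b n)))"
  by (rule Int_stable_directed_coord_algebras) (auto simp: mono_def words_upto_def)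

lemma levels_subset: "(\<Union>n. sets (coord_algebra b (words_upto b n))) \<subseteq> Pow (space (path_space b))"
  using sets.space_closed[of "coord_algebra b _"] by auto

context weighted_cascade
begin

lemma emeasure_spine_law_level:
  assumes mass: "0 < root_mass P F" and t: "t \<in> space (haar b)" and law: "spine_law b P F t Pt"
    and A: "A \<in> sets (coord_algebra b (words_upto b n))"
  shows "emeasure Pt A = ennreal ((\<integral>\<omega>. indicator A \<omega> * vertex_weight F (prefix_of t n) \<omega> \<partial>P) / root_mass P F)"
proof -
  interpret spine_cascade b p0 q P F t Pt
    using mass t law by unfold_locales
  have tn: "prefix_of t n \<in> tree_words b" using t by (rule prefix_of_in_tree_words)
  have "A \<in> sets P" "A \<in> sets Pt"
    using A subalgebra_coord_algebra[OF sets_P words_upto_subset, of n]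
      subalgebra_coord_algebra[OF sets_Pt words_upto_subset, of n]
    by (auto simp: subalgebra_def)
  note this [measurable]
  have int: "integrable P (\<lambda>\<omega>. indicator A \<omega> * vertex_weight F (prefix_of t n) \<omega>)"
    using integrable_mult_indicator[OF \<open>A \<in> sets P\<close> vertex_weight_integrable[OF tn]] by simp
  have "emeasure Pt A = (\<integral>\<^sup>+ \<omega>. indicator A \<omega> \<partial>Pt)" by simp
  also have "\<dots> = (\<integral>\<^sup>+ \<omega>. ennreal (vertex_weight F (prefix_of t n) \<omega> / root_mass P F) * indicator A \<omega> \<partial>P)"
    by (rule nn_integral_spine_law[OF borel_measurable_indicator[OF A]])
  also have "\<dots> = (\<integral>\<^sup>+ \<omega>. ennreal (indicator A \<omega> * vertex_weight F (prefix_of t n) \<omega> / root_mass P F) \<partial>P)"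
    by (intro nn_integral_cong) (simp add: indicator_def)
  also have "\<dots> = ennreal (\<integral>\<omega>. indicator A \<omega> * vertex_weight F (prefix_of t n) \<omega> / root_mass P F \<partial>P)"
    using int mass tn by (intro nn_integral_eq_integral AE_I2)
      (auto simp: space_P intro!: divide_nonneg_pos mult_nonneg_nonneg vertex_weight_nonneg_on_paths)
  finally show ?thesis by simp
qed

text \<open>On a rectangle with one side in the levels up to \<open>n\<close>, both sides are the same finite sum over the
  cylinders of level \<open>n\<close>; such rectangles generate the product sigma-algebra. The spine laws form a
  measurable kernel because on the levels up to \<open>n\<close> they depend on \<open>t\<close> through \<open>t|n\<close> only.\<close>
lemma
  assumes mass: "0 < root_mass P F" and joint: "cascade_joint_law b P F QF"
    and laws: "\<And>t. t \<in> space (haar b) \<Longrightarrow> spine_law b P F t (PF t)"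
    and f: "f \<in> borel_measurable (path_space b \<Otimes>\<^sub>M haar b)"
  shows joint_law_disintegration: "(\<integral>\<^sup>+ x. f x \<partial>QF) = (\<integral>\<^sup>+ t. \<integral>\<^sup>+ \<omega>. f (\<omega>, t) \<partial>PF t \<partial>haar b)"
    and spine_integral_measurable: "(\<lambda>t. \<integral>\<^sup>+ \<omega>. f (\<omega>, t) \<partial>PF t) \<in> borel_measurable (haar b)"
proof -
  let ?\<Omega> = "space (path_space b)" and ?T = "space (haar b)" and ?PT = "path_space b \<Otimes>\<^sub>M haar b"
  let ?E = "\<Union>n. sets (coord_algebra b (words_upto b n))"
  interpret T: prob_space "haar b" using b_pos by (rule prob_space_haar)
  interpret Q: prob_space QF using joint by (simp add: cascade_joint_law_def)
  have sets_QF: "sets QF = sets ?PT" using joint by (simp add: cascade_joint_law_def)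
  have sets_PF: "sets (PF t) = sets (path_space b)" if "t \<in> ?T" for t
    using laws[OF that] by (simp add: spine_law_def)
  have prob_PF: "prob_space (PF t)" if "t \<in> ?T" for t
    using laws[OF that] by (simp add: spine_law_def)
  have "PF \<in> haar b \<rightarrow>\<^sub>M prob_algebra (path_space b)"
  proof (rule measurable_prob_algebra_generated[OF sets_path_space_levels Int_stable_levels levels_subset])
    fix A assume "A \<in> ?E"
    then obtain n where A: "A \<in> sets (coord_algebra b (words_upto b n))" by auto
    let ?e = "\<lambda>\<gamma>. ennreal ((\<integral>\<omega>. indicator A \<omega> * vertex_weight F \<gamma> \<omega> \<partial>P) / root_mass P F)"
    have "(\<lambda>t. ?e (prefix_of t n)) \<in> borel_measurable (haar b)"
      by (rule measurable_compose[OF measurable_prefix[OF b_pos]]) simp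
    then show "(\<lambda>t. emeasure (PF t) A) \<in> borel_measurable (haar b)"
      by (subst measurable_cong[where g="\<lambda>t. ?e (prefix_of t n)"])
        (simp_all add: emeasure_spine_law_level[OF mass _ laws A])
  qed (simp_all add: prob_PF sets_PF)
  then have PF [measurable]: "PF \<in> haar b \<rightarrow>\<^sub>M subprob_algebra (path_space b)"
    by (rule measurable_prob_algebraD)
  show "(\<lambda>t. \<integral>\<^sup>+ \<omega>. f (\<omega>, t) \<partial>PF t) \<in> borel_measurable (haar b)"
    by (rule nn_integral_measurable_subprob_algebra2[OF _ PF]) (use f in measurable)
  let ?K = "\<lambda>t. distr (PF t) ?PT (\<lambda>\<omega>. (\<omega>, t))"
  have K: "?K \<in> haar b \<rightarrow>\<^sub>M subprob_algebra ?PT"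
    by (rule measurable_distr2[OF _ PF]) measurable
  have pair: "(\<lambda>\<omega>. (\<omega>, t)) \<in> PF t \<rightarrow>\<^sub>M ?PT" if "t \<in> ?T" for t
    using that by (subst measurable_cong_sets[OF sets_PF[OF that] refl]) (rule measurable_Pair2')
  have "QF = haar b \<bind> ?K"
  proof (rule measure_eqI_generator_eq)
    let ?R = "{A \<times> B | A B. A \<in> ?E \<and> B \<in> sets (haar b)}"
    have top: "?\<Omega> \<in> ?E" using sets.top[of "coord_algebra b (words_upto b 0)"] by auto
    show "Int_stable ?R"
    proof (rule Int_stableI, clarify)
      fix A B m A' B' n assume "A \<in> sets (coord_algebra b (words_upto b m))" "A' \<in> sets (coord_algebra b (words_upto b n))"
        "B \<in> sets (haar b)" "B' \<in> sets (haar b)"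
      then have "A \<inter> A' \<in> ?E" "B \<inter> B' \<in> sets (haar b)"
        using Int_stableD[OF Int_stable_levels[of b], of A A'] by auto
      then show "\<exists>C D. (A \<times> B) \<inter> (A' \<times> B') = C \<times> D \<and> C \<in> ?E \<and> D \<in> sets (haar b)"
        by (intro exI[of _ "A \<inter> A'"] exI[of _ "B \<inter> B'"]) auto
    qed
    show "?R \<subseteq> Pow (?\<Omega> \<times> ?T)"
      using levels_subset[of b] sets.space_closed[of "haar b"] by blast
    have "sets ?PT = sets (sigma (?\<Omega> \<times> ?T) {A \<times> B | A B. A \<in> ?E \<and> B \<in> sets (haar b)})"
      using top by (intro sets_pair_eq[where Ca="{?\<Omega>}" and Cb="{?T}"] levels_subset sets_path_space_levels)
        (auto simp: sets.sigma_sets_eq sets.space_closed)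
    also have "\<dots> = sigma_sets (?\<Omega> \<times> ?T) ?R"
      by (rule sets_measure_of) fact
    finally show gen: "sets QF = sigma_sets (?\<Omega> \<times> ?T) ?R" by (simp add: sets_QF)
    show "sets (haar b \<bind> ?K) = sigma_sets (?\<Omega> \<times> ?T) ?R"
      using gen sets_QF T.not_empty by (subst sets_bind[where N="?PT"]) auto
    show "range (\<lambda>_::nat. ?\<Omega> \<times> ?T) \<subseteq> ?R" using top by blast
    show "emeasure QF (?\<Omega> \<times> ?T) \<noteq> \<infinity>" by simp
    fix S assume "S \<in> ?R"
    then obtain A B n where S: "S = A \<times> B" and A: "A \<in> sets (coord_algebra b (words_upto b n))"
      and B [measurable]: "B \<in> sets (haar b)" by auto
    have AP: "A \<in> sets (path_space b)" "A \<in> sets P"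
      using A subalgebra_coord_algebra[OF sets_P words_upto_subset] sets_P by (auto simp: subalgebra_def)
    note AP [measurable]
    have SPT: "S \<in> sets ?PT" unfolding S by (rule pair_measureI[OF AP(1) B])
    define I where "I \<gamma> = (\<integral>\<omega>. indicator A \<omega> * vertex_weight F \<gamma> \<omega> \<partial>P)" for \<gamma>
    define cyl where "cyl \<gamma> = {t \<in> ?T. prefix_of t n = \<gamma>}" for \<gamma>
    have cyl [measurable]: "cyl \<gamma> \<in> sets (haar b)" if "\<gamma> \<in> level_words b n" for \<gamma>
      unfolding cyl_def using b_pos that by (rule cylinder_sets)
    have tw: "\<gamma> \<in> tree_words b" if "\<gamma> \<in> level_words b n" for \<gamma> using that by (simp add: level_words_def)
    have I_nonneg: "0 \<le> I \<gamma>" if "\<gamma> \<in> level_words b n" for \<gamma>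
      unfolding I_def using tw[OF that]
      by (intro integral_nonneg_AE AE_I2) (auto simp: space_P vertex_weight_nonneg_on_paths)
    have "(\<integral>x. indicator S x \<partial>QF) = (\<integral>\<omega>. (\<integral>t. indicator S (\<omega>, t) * weighted_density F n t \<omega> \<partial>haar b) \<partial>P) / root_mass P F"
    proof -
      have "S \<in> sets (level_algebra b n \<Otimes>\<^sub>M haar b)"
        unfolding S level_algebra_eq using A B by (rule pair_measureI)
      then have "(\<lambda>x. indicator S x :: real) \<in> borel_measurable (level_algebra b n \<Otimes>\<^sub>M haar b)" by simp
      moreover have "\<exists>C. \<forall>x \<in> space ?PT. \<bar>indicator S x :: real\<bar> \<le> C"
        by (intro exI[of _ 1]) (simp add: indicator_def)
      ultimately show ?thesis using joint unfolding cascade_joint_law_def by blast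
    qed
    also have "(\<integral>\<omega>. (\<integral>t. indicator S (\<omega>, t) * weighted_density F n t \<omega> \<partial>haar b) \<partial>P) =
        (\<integral>\<omega>. (\<Sum>\<gamma>\<in>level_words b n. measure (haar b) (B \<inter> cyl \<gamma>) * (indicator A \<omega> * vertex_weight F \<gamma> \<omega>)) \<partial>P)"
    proof (rule Bochner_Integration.integral_cong[OF refl])
      fix \<omega>
      have "(\<integral>t. indicator S (\<omega>, t) * weighted_density F n t \<omega> \<partial>haar b) =
          (\<integral>t. (\<Sum>\<gamma>\<in>level_words b n. (indicator A \<omega> * vertex_weight F \<gamma> \<omega>) * indicator (B \<inter> cyl \<gamma>) t) \<partial>haar b)"
      proof (rule Bochner_Integration.integral_cong[OF refl])
        fix t assume t: "t \<in> ?T"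
        have "indicator S (\<omega>, t) * weighted_density F n t \<omega> =
            indicator A \<omega> * indicator B t * (\<Sum>\<gamma>\<in>level_words b n. vertex_weight F \<gamma> \<omega> * indicator (cyl \<gamma>) t)"
          unfolding cyl_def sum_over_prefixes[OF t, symmetric, of "\<lambda>\<gamma>. vertex_weight F \<gamma> \<omega>"]
          by (simp add: S weighted_density_eq indicator_times)
        then show "indicator S (\<omega>, t) * weighted_density F n t \<omega> =
            (\<Sum>\<gamma>\<in>level_words b n. (indicator A \<omega> * vertex_weight F \<gamma> \<omega>) * indicator (B \<inter> cyl \<gamma>) t)"
          by (simp add: sum_distrib_left indicator_inter_arith mult_ac)
      qed
      also have "\<dots> = (\<Sum>\<gamma>\<in>level_words b n. measure (haar b) (B \<inter> cyl \<gamma>) * (indicator A \<omega> * vertex_weight F \<gamma> \<omega>))"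
      proof (subst Bochner_Integration.integral_sum)
        show "integrable (haar b) (\<lambda>t. (indicator A \<omega> * vertex_weight F \<gamma> \<omega>) * indicator (B \<inter> cyl \<gamma>) t)"
          if "\<gamma> \<in> level_words b n" for \<gamma>
          using cyl[OF that] B
          by (intro integrable_mult_right integrable_real_indicator) (auto simp: T.emeasure_eq_measure)
      qed (auto simp: mult.commute)
      finally show "(\<integral>t. indicator S (\<omega>, t) * weighted_density F n t \<omega> \<partial>haar b) =
        (\<Sum>\<gamma>\<in>level_words b n. measure (haar b) (B \<inter> cyl \<gamma>) * (indicator A \<omega> * vertex_weight F \<gamma> \<omega>))" .
    qed
    also have "\<dots> = (\<Sum>\<gamma>\<in>level_words b n. measure (haar b) (B \<inter> cyl \<gamma>) * I \<gamma>)"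
    proof (subst Bochner_Integration.integral_sum)
      show "integrable P (\<lambda>\<omega>. measure (haar b) (B \<inter> cyl \<gamma>) * (indicator A \<omega> * vertex_weight F \<gamma> \<omega>))"
        if "\<gamma> \<in> level_words b n" for \<gamma>
        using integrable_mult_indicator[OF AP(2) vertex_weight_integrable[OF tw[OF that]]] by simp
    qed (simp add: I_def)
    finally have "emeasure QF S = ennreal ((\<Sum>\<gamma>\<in>level_words b n. measure (haar b) (B \<inter> cyl \<gamma>) * I \<gamma>) / root_mass P F)"
      using SPT sets_QF by (simp add: Q.emeasure_eq_measure)
    also have "\<dots> = (\<Sum>\<gamma>\<in>level_words b n. ennreal (I \<gamma> / root_mass P F) * emeasure (haar b) (B \<inter> cyl \<gamma>))"
      using I_nonneg mass
      by (simp add: sum_divide_distrib T.emeasure_eq_measure ennreal_mult'[symmetric] ennreal_mult''[symmetric] mult.commute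
          flip: sum_ennreal)
    also have "\<dots> = (\<Sum>\<gamma>\<in>level_words b n. \<integral>\<^sup>+ t. ennreal (I \<gamma> / root_mass P F) * indicator (B \<inter> cyl \<gamma>) t \<partial>haar b)"
      by (intro sum.cong refl nn_integral_cmult_indicator[symmetric]) auto
    also have "\<dots> = (\<integral>\<^sup>+ t. (\<Sum>\<gamma>\<in>level_words b n. ennreal (I \<gamma> / root_mass P F) * indicator (B \<inter> cyl \<gamma>) t) \<partial>haar b)"
      by (subst nn_integral_sum) auto
    also have "\<dots> = (\<integral>\<^sup>+ t. emeasure (?K t) S \<partial>haar b)"
    proof (rule nn_integral_cong)
      fix t assume t: "t \<in> ?T"
      have "(\<Sum>\<gamma>\<in>level_words b n. ennreal (I \<gamma> / root_mass P F) * indicator (B \<inter> cyl \<gamma>) t) =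
          indicator B t * (\<Sum>\<gamma>\<in>level_words b n. ennreal (I \<gamma> / root_mass P F) * indicator (cyl \<gamma>) t)"
        by (simp add: sum_distrib_left indicator_inter_arith mult_ac)
      also have "\<dots> = indicator B t * emeasure (PF t) A"
        unfolding cyl_def sum_over_prefixes[OF t, symmetric, of "\<lambda>\<gamma>. ennreal (I \<gamma> / root_mass P F)"]
        by (simp add: emeasure_spine_law_level[OF mass t laws[OF t] A] I_def)
      also have "\<dots> = emeasure (?K t) S"
      proof -
        have "(\<lambda>\<omega>. (\<omega>, t)) -` S \<inter> space (PF t) = (if t \<in> B then A else {})"
          using sets.sets_into_space[OF AP(1)] sets_eq_imp_space_eq[OF sets_PF[OF t]] by (auto simp: S)
        then show ?thesis using SPT by (simp add: emeasure_distr[OF pair[OF t]])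
      qed
      finally show "(\<Sum>\<gamma>\<in>level_words b n. ennreal (I \<gamma> / root_mass P F) * indicator (B \<inter> cyl \<gamma>) t) = emeasure (?K t) S" .
    qed
    also have "\<dots> = emeasure (haar b \<bind> ?K) S"
      by (rule emeasure_bind[OF T.not_empty K SPT, symmetric])
    finally show "emeasure QF S = emeasure (haar b \<bind> ?K) S" .
  qed auto
  then have "(\<integral>\<^sup>+ x. f x \<partial>QF) = (\<integral>\<^sup>+ t. \<integral>\<^sup>+ x. f x \<partial>?K t \<partial>haar b)"
    using nn_integral_bind[OF f K] by simp
  also have "\<dots> = (\<integral>\<^sup>+ t. \<integral>\<^sup>+ \<omega>. f (\<omega>, t) \<partial>PF t \<partial>haar b)"
    by (rule nn_integral_cong) (simp add: nn_integral_distr[OF pair] f)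
  finally show "(\<integral>\<^sup>+ x. f x \<partial>QF) = (\<integral>\<^sup>+ t. \<integral>\<^sup>+ \<omega>. f (\<omega>, t) \<partial>PF t \<partial>haar b)" .
qed

end

section \<open>Mass bounds and the off-spine submartingale\<close>

theorem theorem2p3:
  fixes b :: nat
    and p0 :: "real measure"
    and q :: "nat \<Rightarrow> (nat \<Rightarrow> real) \<Rightarrow> real measure"
    and P :: "(nat list \<Rightarrow> real) measure"
    and F :: "nat list \<Rightarrow> (nat list \<Rightarrow> real) \<Rightarrow> real"
    and QF :: "((nat list \<Rightarrow> real) \<times> (nat \<Rightarrow> nat)) measure"
    and PF :: "(nat \<Rightarrow> nat) \<Rightarrow> (nat list \<Rightarrow> real) measure"
    and c :: "nat \<Rightarrow> (nat list \<Rightarrow> real) \<Rightarrow> (nat \<Rightarrow> nat) \<Rightarrow> real"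
  assumes "b \<ge> 2"
    and "cascade_generator b p0 q P"
    and "weight_system b P F"
    and "root_mass P F > 0"
    and "cascade_joint_law b P F QF"
    and "\<And>t. t \<in> space (haar b) \<Longrightarrow> spine_law b P F t (PF t)"
    and "\<And>k \<omega> t. \<omega> \<in> space (path_space b) \<Longrightarrow> t \<in> space (haar b) \<Longrightarrow> 0 \<le> c k \<omega> t"
    and "\<And>k t. t \<in> space (haar b) \<Longrightarrow> (\<lambda>\<omega>. c k \<omega> t) \<in> borel_measurable (spine_algebra b t 0)"
    and "\<And>k. (\<lambda>(\<omega>, t). c k \<omega> t) \<in> borel_measurable (path_space b \<Otimes>\<^sub>M haar b)"
    and "(\<integral>\<^sup>+ (\<omega>, t). (\<Sum>k. ennreal (c k \<omega> t)) \<partial>QF) < \<infinity>"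
  shows
    "(\<forall>t \<in> space (haar b). \<forall>n. \<forall>\<omega> \<in> space (path_space b).
        ennreal ((1 / real b) ^ n * path_weight t n \<omega> * F (prefix_of t n) \<omega>)
          \<le> emeasure (cascade_measure b F n \<omega>) (space (haar b)) \<and>
        emeasure (cascade_measure b F n \<omega>) (space (haar b))
          \<le> ennreal ((1 / real b) ^ n * path_weight t n \<omega> * F (prefix_of t n) \<omega>)
            + times_top (spine_sup b c t \<omega>) (ennreal (off_spine_sum b F c t n \<omega>)))
     \<and> (\<forall>t \<in> space (haar b).
        nonneg_submartingale (PF t) (spine_algebra b t) (off_spine_sum b F c t) \<and>
        nonneg_doob_predictable_part (PF t) (spine_algebra b t) (off_spine_sum b F c t)
          (drift b (weighted_coeff F c) t) \<and>
        ((\<forall>n. integrable (PF t) (drift b (weighted_coeff F c) t n)) \<longrightarrow>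
          submartingale (PF t) (spine_algebra b t) (off_spine_sum b F c t) \<and>
          doob_predictable_part (PF t) (spine_algebra b t) (off_spine_sum b F c t)
            (drift b (weighted_coeff F c) t)))
     \<and> (AE t in haar b.
        (\<forall>j. AE \<omega> in PF t. weighted_coeff F c j \<omega> t = c j \<omega> t) \<longrightarrow>
          submartingale (PF t) (spine_algebra b t) (off_spine_sum b F c t) \<and>
          doob_predictable_part (PF t) (spine_algebra b t) (off_spine_sum b F c t)
            (drift b c t))"
proof (intro conjI ballI allI)
  interpret weighted_cascade b p0 q P F
    using assms(1-3) by unfold_locales
  have at: "off_spine b p0 q P F t (PF t) c" if "t \<in> space (haar b)" for t
    using that assms(4,6-8) by unfold_locales auto
  fix t assume t: "t \<in> space (haar b)"
  interpret off_spine b p0 q P F t "PF t" c using t by (rule at)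
  show "ennreal ((1 / real b) ^ n * path_weight t n \<omega> * F (prefix_of t n) \<omega>)
      \<le> emeasure (cascade_measure b F n \<omega>) (space (haar b))"
    and "emeasure (cascade_measure b F n \<omega>) (space (haar b))
      \<le> ennreal ((1 / real b) ^ n * path_weight t n \<omega> * F (prefix_of t n) \<omega>)
        + times_top (spine_sup b c t \<omega>) (ennreal (off_spine_sum b F c t n \<omega>))"
    if \<omega>: "\<omega> \<in> space (path_space b)" for \<omega> n
    using total_mass_bounds[OF b_pos t \<omega>, where F=F and c=c and n=n] by (simp_all add: F_nonneg c_nonneg \<omega>)
  show "nonneg_submartingale (PF t) G X" by (rule nonneg_submartingale_X)
  show "nonneg_doob_predictable_part (PF t) G X (drift b (weighted_coeff F c) t)"
    by (rule nonneg_doob_weighted_drift)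
  show "(\<forall>n. integrable (PF t) (drift b (weighted_coeff F c) t n)) \<longrightarrow>
      submartingale (PF t) G X \<and> doob_predictable_part (PF t) G X (drift b (weighted_coeff F c) t)"
    using submartingale_of_integrable_drift[OF nonneg_doob_weighted_drift] by blast
next
  interpret weighted_cascade b p0 q P F
    using assms(1-3) by unfold_locales
  let ?f = "\<lambda>(\<omega>, t). \<Sum>k. ennreal (c k \<omega> t)"
  have f: "?f \<in> borel_measurable (path_space b \<Otimes>\<^sub>M haar b)"
    using assms(9) by (simp add: case_prod_beta)
  have "(\<integral>\<^sup>+ x. ?f x \<partial>QF) = (\<integral>\<^sup>+ t. \<integral>\<^sup>+ \<omega>. ?f (\<omega>, t) \<partial>PF t \<partial>haar b)"
    using assms(4-6) f by (rule joint_law_disintegration)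
  then have "(\<integral>\<^sup>+ t. \<integral>\<^sup>+ \<omega>. ?f (\<omega>, t) \<partial>PF t \<partial>haar b) \<noteq> \<infinity>"
    using assms(10) by simp
  moreover have "(\<lambda>t. \<integral>\<^sup>+ \<omega>. ?f (\<omega>, t) \<partial>PF t) \<in> borel_measurable (haar b)"
    using assms(4-6) f by (rule spine_integral_measurable)
  ultimately have "AE t in haar b. (\<integral>\<^sup>+ \<omega>. ?f (\<omega>, t) \<partial>PF t) \<noteq> \<infinity>"
    by (intro nn_integral_PInf_AE)
  moreover have "AE t in haar b. t \<in> space (haar b)" by simp
  ultimately show "AE t in haar b. (\<forall>j. AE \<omega> in PF t. weighted_coeff F c j \<omega> t = c j \<omega> t) \<longrightarrow>
      submartingale (PF t) (spine_algebra b t) (off_spine_sum b F c t) \<and>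
      doob_predictable_part (PF t) (spine_algebra b t) (off_spine_sum b F c t) (drift b c t)"
  proof eventually_elim
    case (elim t)
    interpret off_spine b p0 q P F t "PF t" c
      using elim(2) assms(4,6-8) by unfold_locales auto
    show ?case
    proof (intro impI submartingale_of_integrable_drift nonneg_doob_drift c_measurable c_nonneg)
      have le: "(\<integral>\<^sup>+ \<omega>. ennreal (c k \<omega> t) \<partial>PF t) \<le> (\<integral>\<^sup>+ \<omega>. ?f (\<omega>, t) \<partial>PF t)" for k
        by (intro nn_integral_mono) (auto intro: sum_le_suminf[where I="{k}", simplified])
      have "(\<integral>\<^sup>+ \<omega>. ennreal (c k \<omega> t) \<partial>PF t) < \<infinity>" for k
        using le[of k] elim(1) by (simp add: less_top le_less_trans)
      then show "integrable (PF t) (drift b c t n)" for n by (rule integrable_drift)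
    qed auto
  qed
qed

end
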